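(* The map $\mu:K\to\mathcal A$ is well defined and descends to a map $\overline\mu:\widetilde K\to\mathcal A$ on the quotient.
   Context: $[a,b]=aba^{-1}b^{-1}$. $\Gamma_x=\langle y,z,s\mid[y,s],[z,s],[y,z]s^{-1}\rangle$, $\Gamma_y=\langle z,x,t\mid[z,t],[x,t],[z,x]t^{-1}\rangle$, $\Gamma_z=\langle x,y,u\mid[x,u],[y,u],[x,y]u^{-1}\rangle$, $K=\mathbb Z\Gamma_x\times\mathbb Z\Gamma_y\times\mathbb Z\Gamma_z$. Elements of $K$ are uniquely triples of finite sums $\left(\sum a_{ijk}y^is^jz^k,\sum b_{ijk}z^it^jx^k,\sum c_{ijk}x^iu^jy^k\right)$. $\mathbb Z^6$ acts on $K$ by letting $(a,b,c,d,e,f)$ send this triple to $\left(\sum a_{ijk}y^is^{j+(b-c)i+(f-a)k}z^k,\ \sum b_{ijk}z^it^{j+(d-e)i+(b-c)k}x^k,\ \sum c_{ijk}x^iu^{j+(f-a)i+(d-e)k}y^k\right)$, and $\widetilde K$ is the orbit space. For non-negative integers $n_1,n_2,n_3$ put $n=2n_1+2n_2+2n_3$ and $\mathbb Z^n=(\mathbb Z^2)^{n_1}\times(\mathbb Z^2)^{n_2}\times(\mathbb Z^2)^{n_3}$. The group $\mathcal S_{n_1}\times\mathcal S_{n_2}\times\mathcal S_{n_3}$ acts on $\mathbb Z^n$ by permuting the $\mathbb Z^2$ factors within each of the three blocks; $P_{(n_1,n_2,n_3)}$ is the corresponding group of matrices. Let $A_k(\mathbb Z^n)=\{x+N\mid x\in\mathbb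 Z^n,\ N\text{ a submodule of }\mathbb Z^n\text{ of rank }k\}$, $\mathcal A_{(n_1,n_2,n_3)}=\coprod_{k=0}^3A_k(\mathbb Z^n)/P_{(n_1,n_2,n_3)}$ and $\mathcal A=\coprod_{(n_1,n_2,n_3)\in\mathbb Z_{\ge0}^3}\mathcal A_{(n_1,n_2,n_3)}$. The map $\mu$: given $v\in K$ written uniquely as a triple of finite sums $v=\left(\sum a_{ijk}y^is^jz^k,\sum b_{ijk}z^it^jx^k,\sum c_{ijk}x^iu^jy^k\right)$, let $n_1,n_2,n_3$ be the numbers of nonzero coefficients $a_{ijk}$, $b_{ijk}$, $c_{ijk}$ respectively. Order the nonzero coefficients as $a_{i_lj_lk_l}$ ($1\le l\le n_1$), $b_{i'_lj'_lk'_l}$ ($1\le l\le n_2$), $c_{i''_lj''_lk''_l}$ ($1\le l\le n_3$). Then $\mu(v)\in\mathcal A_{(n_1,n_2,n_3)}$ is the class of the affine subset of $\mathbb Z^n$ consisting of all vectors, for $(q_1,q_2,q_3)\in\mathbb Z^3$, whose $l$th pair in the first block is $(j_l+q_1k_l+q_2i_l,\ a_{i_lj_lk_l})$, whose $l$th pair in the second block is $(j'_l+q_2k'_l+q_3i'_l,\ b_{i'_lj'_lk'_l})$, and whose $l$th pair in the third block is $(j''_l+q_1i''_l+q_3k''_l,\ c_{i''_lj''_lk''_l})$. *)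

theory Defs
  imports
    "HOL-Combinatorics.Permutations"
    "HOL-Algebra.Group_Action"
    "HOL-Algebra.Elementary_Groups"
    "HOL-Algebra.Chinese_Remainder"
    "Jordan_Normal_Form.VS_Connect"
begin

section \<open>Groups given by generators and relators\<close>

text \<open>The letter \<open>(x, True)\<close> stands for the generator \<open>x\<close> and \<open>(x, False)\<close> for its inverse.\<close>

type_synonym 'g word = "('g \<times> bool) list"

definition words :: "'g set \<Rightarrow> 'g word set" where
  "words X = lists (X \<times> UNIV)"

definition word_inv :: "'g word \<Rightarrow> 'g word" where
  "word_inv w = map (\<lambda>(x, b). (x, \<not> b)) (rev w)"

definition word_comm :: "'g word \<Rightarrow> 'g word \<Rightarrow> 'g word" where
  "word_comm a b = a @ b @ word_inv a @ word_inv b"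

inductive pres_eq :: "'g set \<Rightarrow> 'g word set \<Rightarrow> 'g word \<Rightarrow> 'g word \<Rightarrow> bool"
  for X :: "'g set" and R :: "'g word set" where
  pres_refl: "w \<in> words X \<Longrightarrow> pres_eq X R w w"
| pres_sym: "pres_eq X R u v \<Longrightarrow> pres_eq X R v u"
| pres_trans: "pres_eq X R u v \<Longrightarrow> pres_eq X R v w \<Longrightarrow> pres_eq X R u w"
| pres_cancel: "u \<in> words X \<Longrightarrow> v \<in> words X \<Longrightarrow> x \<in> X \<Longrightarrow>
    pres_eq X R (u @ [(x, b), (x, \<not> b)] @ v) (u @ v)"
| pres_relator: "u \<in> words X \<Longrightarrow> v \<in> words X \<Longrightarrow> r \<in> R \<inter> words X \<Longrightarrow>
    pres_eq X R (u @ r @ v) (u @ v)"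

definition pres_class :: "'g set \<Rightarrow> 'g word set \<Rightarrow> 'g word \<Rightarrow> 'g word set" where
  "pres_class X R w = {w'. pres_eq X R w w'}"

definition presented_group :: "'g set \<Rightarrow> 'g word set \<Rightarrow> 'g word set monoid" where
  "presented_group X R =
     \<lparr>carrier = pres_class X R ` words X,
      monoid.mult = (\<lambda>A B. \<Union>a\<in>A. \<Union>b\<in>B. pres_class X R (a @ b)),
      one = pres_class X R []\<rparr>"

section \<open>Integral group rings\<close>

definition group_ring :: "('g, 'm) monoid_scheme \<Rightarrow> ('g \<Rightarrow> int) ring" where
  "group_ring G =
     \<lparr>carrier = {f. finite {g. f g \<noteq> 0} \<and> {g. f g \<noteq> 0} \<subseteq> carrier G},
      monoid.mult = (\<lambda>f h x. \<Sum>(g, g') \<in> {(g, g'). f g \<noteq> 0 \<and> h g' \<noteq> 0 \<and> g \<otimes>\<^bsub>G\<^esub> g' = x}. f g * h g'),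
      one = (\<lambda>x. if x = \<one>\<^bsub>G\<^esub> then 1 else 0),
      zero = (\<lambda>_. 0),
      add = (\<lambda>f h x. f x + h x)\<rparr>"

section \<open>The ring K\<close>

datatype letter = Gx | Gy | Gz | Gs | Gt | Gu

definition heis_rels :: "letter \<Rightarrow> letter \<Rightarrow> letter \<Rightarrow> letter word set" where
  "heis_rels p q r =
     {word_comm [(p, True)] [(r, True)],
      word_comm [(q, True)] [(r, True)],
      word_comm [(p, True)] [(q, True)] @ word_inv [(r, True)]}"

definition heis :: "letter \<Rightarrow> letter \<Rightarrow> letter \<Rightarrow> letter word set monoid" where
  "heis p q r = presented_group {p, q, r} (heis_rels p q r)"

abbreviation "Gamma_x \<equiv> heis Gy Gz Gs"
abbreviation "Gamma_y \<equiv> heis Gz Gx Gt"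
abbreviation "Gamma_z \<equiv> heis Gx Gy Gu"

definition K_ring :: "((letter word set \<Rightarrow> int) \<times> (letter word set \<Rightarrow> int) \<times> (letter word set \<Rightarrow> int)) ring" where
  "K_ring = RDirProd (group_ring Gamma_x) (RDirProd (group_ring Gamma_y) (group_ring Gamma_z))"

definition heis_gen :: "letter \<Rightarrow> letter \<Rightarrow> letter \<Rightarrow> letter \<Rightarrow> letter word set" where
  "heis_gen p q r x = pres_class {p, q, r} (heis_rels p q r) [(x, True)]"

text \<open>The group element \<open>p\<^sup>i r\<^sup>j q\<^sup>k\<close>; note that the central generator \<open>r\<close> is in the middle.\<close>

definition heis_monom :: "letter \<Rightarrow> letter \<Rightarrow> letter \<Rightarrow> int \<times> int \<times> int \<Rightarrow> letter word set" where
  "heis_monom p q r = (\<lambda>(i, j, k).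
     heis_gen p q r p [^]\<^bsub>heis p q r\<^esub> i \<otimes>\<^bsub>heis p q r\<^esub>
     heis_gen p q r r [^]\<^bsub>heis p q r\<^esub> j \<otimes>\<^bsub>heis p q r\<^esub>
     heis_gen p q r q [^]\<^bsub>heis p q r\<^esub> k)"

text \<open>\<open>v = (\<Sum> a\<^sub>i\<^sub>j\<^sub>k p\<^sup>i r\<^sup>j q\<^sup>k)\<close> as a finite sum in the group ring.\<close>

definition expands :: "letter \<Rightarrow> letter \<Rightarrow> letter \<Rightarrow> (letter word set \<Rightarrow> int) \<Rightarrow>
    (int \<times> int \<times> int \<Rightarrow> int) \<Rightarrow> bool" where
  "expands p q r v a \<longleftrightarrow> finite {m. a m \<noteq> 0} \<and>
     v = (\<lambda>g. \<Sum>m | a m \<noteq> 0. if g = heis_monom p q r m then a m else 0)"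

definition coeffs_of :: "letter \<Rightarrow> letter \<Rightarrow> letter \<Rightarrow> (letter word set \<Rightarrow> int) \<Rightarrow>
    (int \<times> int \<times> int \<Rightarrow> int)" where
  "coeffs_of p q r v = (THE a. expands p q r v a)"

section \<open>The action on K and its orbit space\<close>

text \<open>\<open>\<Sum> a\<^sub>i\<^sub>j\<^sub>k p\<^sup>i r\<^sup>j q\<^sup>k\<close> is sent to the sum of the
  \<open>a\<^sub>i\<^sub>j\<^sub>k p\<^sup>i r\<^sup>j\<^sup>' q\<^sup>k\<close> with \<open>j' = j + \<alpha> i + \<beta> k\<close>.\<close>

definition shear :: "letter \<Rightarrow> letter \<Rightarrow> letter \<Rightarrow> int \<Rightarrow> int \<Rightarrow>
    (letter word set \<Rightarrow> int) \<Rightarrow> (letter word set \<Rightarrow> int)" where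
  "shear p q r \<alpha> \<beta> v = (let a = coeffs_of p q r v in
     (\<lambda>g. \<Sum>(i, j, k) | a (i, j, k) \<noteq> 0.
        if g = heis_monom p q r (i, j + \<alpha> * i + \<beta> * k, k) then a (i, j, k) else 0))"

definition Z6 :: "(int \<times> int \<times> int \<times> int \<times> int \<times> int) monoid" where
  "Z6 = integer_group \<times>\<times> integer_group \<times>\<times> integer_group \<times>\<times>
        integer_group \<times>\<times> integer_group \<times>\<times> integer_group"

definition K_act where
  "K_act = (\<lambda>(a, b, c, d, e, f) (v\<^sub>1, v\<^sub>2, v\<^sub>3).
     (shear Gy Gz Gs (b - c) (f - a) v\<^sub>1,
      shear Gz Gx Gt (d - e) (b - c) v\<^sub>2,
      shear Gx Gy Gu (f - a) (d - e) v\<^sub>3))"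

definition K_tilde where
  "K_tilde = orbits Z6 (carrier K_ring) K_act"

section \<open>Affine subsets up to block permutations\<close>

type_synonym blocks = "nat \<times> nat \<times> nat"

text \<open>Pair number \<open>l\<close> (counting from 0 through all three blocks) of a vector in \<open>\<int>\<^sup>n\<close>
  consists of the coordinates \<open>2 l\<close> and \<open>2 l + 1\<close>.\<close>

definition zdim :: "blocks \<Rightarrow> nat" where
  "zdim = (\<lambda>(n1, n2, n3). 2 * n1 + 2 * n2 + 2 * n3)"

definition block_perm :: "blocks \<Rightarrow> (nat \<Rightarrow> nat) \<Rightarrow> (nat \<Rightarrow> nat) \<Rightarrow> (nat \<Rightarrow> nat) \<Rightarrow> nat \<Rightarrow> nat" where
  "block_perm = (\<lambda>(n1, n2, n3) \<sigma> \<tau> \<rho> l.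
     if l < n1 then \<sigma> l
     else if l < n1 + n2 then n1 + \<tau> (l - n1)
     else n1 + n2 + \<rho> (l - n1 - n2))"

definition pair_perm_mat :: "nat \<Rightarrow> (nat \<Rightarrow> nat) \<Rightarrow> int mat" where
  "pair_perm_mat n \<pi> =
     mat n n (\<lambda>(r, c). if r div 2 = \<pi> (c div 2) \<and> r mod 2 = c mod 2 then 1 else 0)"

definition block_perm_group :: "blocks \<Rightarrow> int mat monoid" where
  "block_perm_group ns = (case ns of (n1, n2, n3) \<Rightarrow>
     \<lparr>carrier = {pair_perm_mat (zdim ns) (block_perm ns \<sigma> \<tau> \<rho>) | \<sigma> \<tau> \<rho>.
        \<sigma> permutes {..<n1} \<and> \<tau> permutes {..<n2} \<and> \<rho> permutes {..<n3}},
      monoid.mult = (*), one = 1\<^sub>m (zdim ns)\<rparr>)"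

definition mat_act :: "int mat \<Rightarrow> int vec set \<Rightarrow> int vec set" where
  "mat_act M A = (\<lambda>x. M *\<^sub>v x) ` A"

abbreviation Zmod :: "nat \<Rightarrow> (int, int vec) module" where
  "Zmod n \<equiv> module_vec TYPE(int) n"

text \<open>Rank over the integers: the largest size of a linearly independent subset.
It is bounded by \<open>n\<close>, so the greatest element exists.\<close>

definition Zrank :: "nat \<Rightarrow> int vec set \<Rightarrow> nat" where
  "Zrank n N = (GREATEST k. \<exists>B \<subseteq> N. finite B \<and> card B = k \<and>
     \<not> LinearCombinations.module.lin_dep class_ring (Zmod n) B)"

definition affine_sets :: "nat \<Rightarrow> nat \<Rightarrow> int vec set set" where
  "affine_sets k n = {{x + y | y. y \<in> N} | x N.
     x \<in> carrier_vec n \<and> LinearCombinations.submodule class_ring N (Zmod n) \<and> Zrank n N = k}"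

text \<open>Both coproducts are tagged unions, so an element of \<open>\<A>\<close> is
  \<open>((n\<^sub>1, n\<^sub>2, n\<^sub>3), k, orbit)\<close>.\<close>

definition calA_block :: "blocks \<Rightarrow> (nat \<times> int vec set set) set" where
  "calA_block ns = (SIGMA k:{0..3}. orbits (block_perm_group ns) (affine_sets k (zdim ns)) mat_act)"

definition calA :: "(blocks \<times> nat \<times> int vec set set) set" where
  "calA = (SIGMA ns:UNIV. calA_block ns)"

section \<open>The map mu\<close>

definition mu_vec :: "(int \<times> int \<times> int \<Rightarrow> int) \<Rightarrow> (int \<times> int \<times> int \<Rightarrow> int) \<Rightarrow>
    (int \<times> int \<times> int \<Rightarrow> int) \<Rightarrow>
    (int \<times> int \<times> int) list \<Rightarrow> (int \<times> int \<times> int) list \<Rightarrow> (int \<times> int \<times> int) list \<Rightarrow>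
    int \<Rightarrow> int \<Rightarrow> int \<Rightarrow> int vec" where
  "mu_vec a b c la lb lc q1 q2 q3 = vec_of_list
     (concat (map (\<lambda>(i, j, k). [j + q1 * k + q2 * i, a (i, j, k)]) la) @
      concat (map (\<lambda>(i, j, k). [j + q2 * k + q3 * i, b (i, j, k)]) lb) @
      concat (map (\<lambda>(i, j, k). [j + q1 * i + q3 * k, c (i, j, k)]) lc))"

definition mu_set where
  "mu_set a b c la lb lc = {mu_vec a b c la lb lc q1 q2 q3 | q1 q2 q3. True}"

text \<open>The relation \<open>mu_rel v X\<close> says that \<open>X\<close> is a value produced by the recipe for \<open>\<mu>(v)\<close>, for some way of writing
  \<open>v\<close> as a triple of finite sums, some ordering of the nonzero coefficients, and some \<open>k\<close>
  for which the resulting set is an affine subset of rank \<open>k\<close>. That \<open>\<mu>\<close> is well defined means that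
  there is exactly one such \<open>X\<close>, and that it lies in \<open>\<A>\<close>.\<close>

definition mu_rel where
  "mu_rel = (\<lambda>(v\<^sub>1, v\<^sub>2, v\<^sub>3) X. \<exists>a b c la lb lc k.
     expands Gy Gz Gs v\<^sub>1 a \<and> expands Gz Gx Gt v\<^sub>2 b \<and> expands Gx Gy Gu v\<^sub>3 c \<and>
     distinct la \<and> set la = {m. a m \<noteq> 0} \<and>
     distinct lb \<and> set lb = {m. b m \<noteq> 0} \<and>
     distinct lc \<and> set lc = {m. c m \<noteq> 0} \<and>
     (let ns = (length la, length lb, length lc); A = mu_set a b c la lb lc in
        A \<in> affine_sets k (zdim ns) \<and> X = (ns, k, orbit (block_perm_group ns) mat_act A)))"

definition mu where
  "mu v = (THE X. mu_rel v X)"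

end

theory Submission
  imports Defs
begin

text \<open>
  Each of the three groups is a discrete Heisenberg group, generated by \<open>p\<close>, \<open>q\<close> and a central
  element \<open>r\<close> with \<open>p q = r q p\<close>. Its elements have the unique normal form \<open>p\<^sup>i r\<^sup>j q\<^sup>k\<close>
  (\<open>hmon_bij\<close>): existence is a calculation in the group, uniqueness comes from letting words act on
  integer triples by the multiplication law of the normal form. Hence an element of the group ring
  has exactly one coefficient function (\<open>expands_iff\<close>), and the only freedom left in the recipe for
  \<open>\<mu>\<close> is the order in which the nonzero coefficients are listed.

  For a fixed order the recipe produces a point plus the image of a linear map from \<open>\<int>\<^sup>3\<close>. This is
  an affine subset, and its rank is at most \<open>3\<close> because four integral linear combinations of
  three vectors satisfy a nontrivial integral relation (\<open>mu_set_affine\<close>). Changing the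
  order permutes the pairs inside the three blocks, so the affine subset changes by a block
  permutation matrix (\<open>mu_set_reorder\<close>). Such a matrix permutes coordinates and therefore
  preserves the rank, and its products with block permutation matrices are again of that kind, so
  both the rank and the orbit are independent of the order. This makes \<open>\<mu>\<close> well defined
  (\<open>mu_rel_unique\<close>).

  The group \<open>\<int>\<^sup>6\<close> acts through three integers \<open>\<alpha> = b - c\<close>, \<open>\<beta> = f - a\<close>, \<open>\<gamma> = d - e\<close>, adding to each
  exponent \<open>j\<close> the same linear form in \<open>i\<close> and \<open>k\<close> that the parameters \<open>q\<^sub>1, q\<^sub>2, q\<^sub>3\<close> contribute to the
  corresponding coordinate. The action therefore only translates the parameters
  by \<open>(\<beta>, \<alpha>, \<gamma>)\<close> and leaves the affine subset, a union over all parameters, unchanged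
  (\<open>mu_set_shear\<close>). So \<open>\<mu>\<close> is constant on orbits and descends to the orbit space.
\<close>

section \<open>Groups given by generators and relators\<close>

lemma words_append [simp]: "u @ v \<in> words X \<longleftrightarrow> u \<in> words X \<and> v \<in> words X"
  and words_Cons [simp]: "(x, b) # w \<in> words X \<longleftrightarrow> x \<in> X \<and> w \<in> words X"
  and words_Nil [simp]: "[] \<in> words X"
  by (auto simp: words_def)

lemma word_inv_Nil [simp]: "word_inv [] = []"
  and word_inv_Cons [simp]: "word_inv ((x, b) # w) = word_inv w @ [(x, \<not> b)]"
  by (simp_all add: word_inv_def)

lemma word_inv_in_words [simp]: "w \<in> words X \<Longrightarrow> word_inv w \<in> words X"
  by (induction w) auto

lemma pres_eq_words: "pres_eq X R u v \<Longrightarrow> u \<in> words X \<and> v \<in> words X"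
  by (induction rule: pres_eq.induct) auto

lemma pres_eq_append_left:
  "pres_eq X R u v \<Longrightarrow> w \<in> words X \<Longrightarrow> pres_eq X R (w @ u) (w @ v)"
proof (induction rule: pres_eq.induct)
  case (pres_sym u v)
  then show ?case by (blast intro: pres_eq.pres_sym)
next
  case (pres_trans u v w')
  then show ?case by (blast intro: pres_eq.pres_trans)
next
  case (pres_cancel u v x b)
  then show ?case using pres_eq.pres_cancel[of "w @ u" X v x R b] by simp
next
  case (pres_relator u v r)
  then show ?case using pres_eq.pres_relator[of "w @ u" X v r R] by simp
qed (simp add: pres_refl)

lemma pres_eq_append_right:
  "pres_eq X R u v \<Longrightarrow> w \<in> words X \<Longrightarrow> pres_eq X R (u @ w) (v @ w)"
proof (induction rule: pres_eq.induct)
  case (pres_sym u v)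
  then show ?case by (blast intro: pres_eq.pres_sym)
next
  case (pres_trans u v w')
  then show ?case by (blast intro: pres_eq.pres_trans)
next
  case (pres_cancel u v x b)
  then show ?case using pres_eq.pres_cancel[of u X "v @ w" x R b] by simp
next
  case (pres_relator u v r)
  then show ?case using pres_eq.pres_relator[of u X "v @ w" r R] by simp
qed (simp add: pres_refl)

lemma pres_eq_append:
  assumes "pres_eq X R u u'" "pres_eq X R v v'"
  shows "pres_eq X R (u @ v) (u' @ v')"
proof (rule pres_trans)
  show "pres_eq X R (u @ v) (u' @ v)"
    using assms pres_eq_words by (intro pres_eq_append_right) auto
  show "pres_eq X R (u' @ v) (u' @ v')"
    using assms pres_eq_words by (intro pres_eq_append_left) auto
qed

lemma pres_class_self: "w \<in> words X \<Longrightarrow> w \<in> pres_class X R w"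
  by (simp add: pres_class_def pres_refl)

lemma pres_class_eq_iff:
  assumes "u \<in> words X"
  shows "pres_class X R u = pres_class X R v \<longleftrightarrow> pres_eq X R u v"
proof
  assume "pres_class X R u = pres_class X R v"
  with pres_class_self[OF assms] have "u \<in> pres_class X R v" by blast
  then have "pres_eq X R v u" by (simp add: pres_class_def)
  then show "pres_eq X R u v" by (rule pres_sym)
next
  assume uv: "pres_eq X R u v"
  have "pres_eq X R u w \<longleftrightarrow> pres_eq X R v w" for w
    using pres_trans[OF uv, of w] pres_trans[OF pres_sym[OF uv], of w] by blast
  then show "pres_class X R u = pres_class X R v" by (simp add: pres_class_def)
qed

text \<open>The product of two classes is defined as a union over all representatives; since concatenation
  respects the congruence, every member of that union is the same class.\<close>

lemma presented_group_mult:
  assumes "u \<in> words X" "v \<in> words X"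
  shows "pres_class X R u \<otimes>\<^bsub>presented_group X R\<^esub> pres_class X R v = pres_class X R (u @ v)"
proof -
  have "pres_class X R (a @ b) = pres_class X R (u @ v)"
    if "a \<in> pres_class X R u" "b \<in> pres_class X R v" for a b
  proof -
    have "pres_eq X R (u @ v) (a @ b)"
      using that by (simp add: pres_class_def pres_eq_append)
    then have "pres_class X R (u @ v) = pres_class X R (a @ b)"
      using assms by (simp add: pres_class_eq_iff)
    then show ?thesis by (rule sym)
  qed
  moreover have "pres_class X R u \<noteq> {}" "pres_class X R v \<noteq> {}"
    using assms[THEN pres_class_self] by blast+
  ultimately have "(\<Union>a\<in>pres_class X R u. \<Union>b\<in>pres_class X R v. pres_class X R (a @ b)) =
      pres_class X R (u @ v)"
    by simp
  then show ?thesis by (simp add: presented_group_def)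
qed

lemma pres_eq_word_inv_left: "w \<in> words X \<Longrightarrow> pres_eq X R (word_inv w @ w) []"
proof (induction w)
  case Nil
  then show ?case by (simp add: pres_refl)
next
  case (Cons a w)
  obtain x b where a: "a = (x, b)" by (cases a)
  with Cons.prems have "pres_eq X R (word_inv w @ [(x, \<not> b), (x, \<not> \<not> b)] @ w) (word_inv w @ w)"
    by (intro pres_cancel) auto
  with Cons a show ?case by (simp add: pres_trans[OF _ Cons.IH])
qed

lemma carrier_presented_group: "carrier (presented_group X R) = pres_class X R ` words X"
  and one_presented_group: "\<one>\<^bsub>presented_group X R\<^esub> = pres_class X R []"
  by (simp_all add: presented_group_def)

lemma pres_class_closed [simp]: "w \<in> words X \<Longrightarrow> pres_class X R w \<in> carrier (presented_group X R)"
  by (simp add: carrier_presented_group)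

lemma group_presented_group: "group (presented_group X R)"
proof (rule groupI)
  fix A assume "A \<in> carrier (presented_group X R)"
  then obtain w where w: "w \<in> words X" "A = pres_class X R w"
    by (auto simp: carrier_presented_group)
  show "\<exists>B\<in>carrier (presented_group X R). B \<otimes>\<^bsub>presented_group X R\<^esub> A = \<one>\<^bsub>presented_group X R\<^esub>"
  proof
    show "pres_class X R (word_inv w) \<otimes>\<^bsub>presented_group X R\<^esub> A = \<one>\<^bsub>presented_group X R\<^esub>"
      using w pres_eq_word_inv_left[of w X R]
      by (simp add: presented_group_mult one_presented_group pres_class_eq_iff)
  qed (use w in simp)
next
  fix A B C
  assume "A \<in> carrier (presented_group X R)" "B \<in> carrier (presented_group X R)"
    "C \<in> carrier (presented_group X R)"
  then obtain u v w where "u \<in> words X" "v \<in> words X" "w \<in> words X"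
      "A = pres_class X R u" "B = pres_class X R v" "C = pres_class X R w"
    unfolding carrier_presented_group by blast
  then show "A \<otimes>\<^bsub>presented_group X R\<^esub> B \<otimes>\<^bsub>presented_group X R\<^esub> C =
      A \<otimes>\<^bsub>presented_group X R\<^esub> (B \<otimes>\<^bsub>presented_group X R\<^esub> C)"
    by (simp add: presented_group_mult)
next
  fix A B
  assume "A \<in> carrier (presented_group X R)" "B \<in> carrier (presented_group X R)"
  then obtain u v where "u \<in> words X" "v \<in> words X"
      "A = pres_class X R u" "B = pres_class X R v"
    unfolding carrier_presented_group by blast
  then show "A \<otimes>\<^bsub>presented_group X R\<^esub> B \<in> carrier (presented_group X R)"
    by (simp add: presented_group_mult)
next
  fix A
  assume "A \<in> carrier (presented_group X R)"
  then obtain u where "u \<in> words X" "A = pres_class X R u"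
    unfolding carrier_presented_group by blast
  then show "\<one>\<^bsub>presented_group X R\<^esub> \<otimes>\<^bsub>presented_group X R\<^esub> A = A"
    by (simp add: presented_group_mult one_presented_group)
qed (simp add: one_presented_group)

lemma presented_group_inv_letter:
  assumes "x \<in> X"
  shows "inv\<^bsub>presented_group X R\<^esub> (pres_class X R [(x, True)]) = pres_class X R [(x, False)]"
proof -
  interpret group "presented_group X R" by (rule group_presented_group)
  show ?thesis
    using assms pres_eq_word_inv_left[of "[(x, True)]" X R]
    by (intro inv_equality) (simp_all add: presented_group_mult one_presented_group pres_class_eq_iff)
qed

lemma pres_class_relator:
  assumes "r \<in> R" "r \<in> words X"
  shows "pres_class X R r = \<one>\<^bsub>presented_group X R\<^esub>"
  using assms pres_relator[of "[]" X "[]" r R]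
  by (simp add: one_presented_group pres_class_eq_iff)

section \<open>The normal form in the Heisenberg group\<close>

text \<open>The relation \<open>g x = y g\<close> says that conjugation by \<open>g\<close> carries \<open>x\<close> to \<open>y\<close>, hence also the powers of
  \<open>x\<close> to those of \<open>y\<close>. It moves powers of one generator past another generator.\<close>

lemma (in group) int_pow_intertwine:
  fixes n :: int
  assumes carr: "g \<in> carrier G" "x \<in> carrier G" "y \<in> carrier G" and eq: "g \<otimes> x = y \<otimes> g"
  shows "g \<otimes> x [^] n = y [^] n \<otimes> g"
proof -
  have inv_eq: "g \<otimes> inv x = inv y \<otimes> g"
    using carr eq by (metis inv_closed inv_solve_left inv_solve_right m_assoc m_closed)
  show ?thesis
  proof (induction n rule: int_induct[where k = 0])
    case base
    then show ?case using carr by simp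
  next
    case (step1 n)
    have "g \<otimes> x [^] (n + 1) = (g \<otimes> x [^] n) \<otimes> x"
      using carr by (simp add: int_pow_mult m_assoc)
    also have "\<dots> = y [^] n \<otimes> (g \<otimes> x)"
      using carr step1 by (simp add: m_assoc)
    also have "\<dots> = y [^] (n + 1) \<otimes> g"
      using carr eq by (simp add: int_pow_mult m_assoc)
    finally show ?case .
  next
    case (step2 n)
    have "g \<otimes> x [^] (n - 1) = (g \<otimes> x [^] n) \<otimes> inv x"
      using carr by (simp add: int_pow_diff m_assoc)
    also have "\<dots> = y [^] n \<otimes> (g \<otimes> inv x)"
      using carr step2 by (simp add: m_assoc)
    also have "\<dots> = y [^] (n - 1) \<otimes> g"
      using carr inv_eq by (simp add: int_pow_diff m_assoc)
    finally show ?case .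
  qed
qed

text \<open>Right multiplication of \<open>p\<^sup>i r\<^sup>j q\<^sup>k\<close> by a letter, read off on the exponents: moving \<open>p\<^sup>e\<close> to the left past
  \<open>q\<^sup>k\<close> costs \<open>r\<close> to the power \<open>- e k\<close>, because \<open>p q = r q p\<close> with \<open>r\<close> central. Letters other than
  \<open>p\<close> and \<open>q\<close> are treated as \<open>r\<close>.\<close>

fun heis_step :: "letter \<Rightarrow> letter \<Rightarrow> letter \<times> bool \<Rightarrow> int \<times> int \<times> int \<Rightarrow> int \<times> int \<times> int" where
  "heis_step p q (x, b) (i, j, k) = (let e = if b then 1 else - 1 in
     if x = p then (i + e, j - e * k, k) else if x = q then (i, j, k + e) else (i, j + e, k))"

locale heis_letters =
  fixes p q r :: letter
  assumes distinct_letters: "p \<noteq> q" "p \<noteq> r" "q \<noteq> r"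
begin

abbreviation "H \<equiv> heis p q r"
abbreviation "gen \<equiv> heis_gen p q r"
abbreviation "hmon \<equiv> heis_monom p q r"
abbreviation "cls \<equiv> pres_class {p, q, r} (heis_rels p q r)"
abbreviation "run \<equiv> fold (heis_step p q)"

lemma heis_step_inverse: "heis_step p q (x, \<not> b) (heis_step p q (x, b) m) = m"
  by (cases m) (auto simp: Let_def)

lemma run_relator: "w \<in> heis_rels p q r \<Longrightarrow> run w m = m"
  using distinct_letters
  by (cases m) (auto simp: heis_rels_def word_comm_def Let_def)

text \<open>Every relator acts trivially on exponent triples, so the words act on triples through the
  presented group. This is what separates elements of the group: a concrete model replaces a
  confluence argument for the rewriting of words.\<close>

lemma run_cong: "pres_eq {p, q, r} (heis_rels p q r) u v \<Longrightarrow> run u m = run v m"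
  by (induction arbitrary: m rule: pres_eq.induct) (auto simp: heis_step_inverse run_relator)

text \<open>The triple \<open>(i, j, k)\<close> is reached from the origin by spelling out \<open>p\<^sup>i r\<^sup>j q\<^sup>k\<close>.\<close>

lemma run_surj: "\<exists>w \<in> words {p, q, r}. run w (0, 0, 0) = m"
proof -
  obtain i j k where m: "m = (i, j, k)" by (cases m)
  \<comment> \<open>the word spelling the power \<open>x\<^sup>n\<close>, with inverse letters for negative \<open>n\<close>\<close>
  define pw where "pw x n = replicate (nat \<bar>n\<bar>) (x, 0 \<le> n)" for x :: letter and n :: int
  have p: "(heis_step p q (p, b) ^^ n) (i, j, k) =
      (if b then (i + int n, j - int n * k, k) else (i - int n, j + int n * k, k))" for n b i j k
    by (induction n arbitrary: i j k) (auto simp: Let_def algebra_simps)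
  have q: "(heis_step p q (q, b) ^^ n) (i, j, k) =
      (if b then (i, j, k + int n) else (i, j, k - int n))" for n b i j k
    using distinct_letters
    by (induction n arbitrary: i j k) (auto simp: Let_def algebra_simps)
  have r: "(heis_step p q (r, b) ^^ n) (i, j, k) =
      (if b then (i, j + int n, k) else (i, j - int n, k))" for n b i j k
    using distinct_letters
    by (induction n arbitrary: i j k) (auto simp: Let_def algebra_simps)
  have "run (pw p i @ pw r j @ pw q k) (0, 0, 0) = m"
    by (auto simp: pw_def m p q r)
  moreover have "pw p i @ pw r j @ pw q k \<in> words {p, q, r}"
    by (auto simp: pw_def words_def)
  ultimately show ?thesis by blast
qed

sublocale G: group H
  unfolding heis_def by (rule group_presented_group)

lemma gen_closed [simp]: "x \<in> {p, q, r} \<Longrightarrow> gen x \<in> carrier H"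
  by (auto simp: heis_def heis_gen_def carrier_presented_group)

lemma word_pair_mult:
  "x \<in> {p, q, r} \<Longrightarrow> y \<in> {p, q, r} \<Longrightarrow> gen x \<otimes>\<^bsub>H\<^esub> gen y = cls [(x, True), (y, True)]"
  by (auto simp: heis_def heis_gen_def presented_group_mult)

lemma gen_inv: "x \<in> {p, q, r} \<Longrightarrow> inv\<^bsub>H\<^esub> (gen x) = cls [(x, False)]"
  unfolding heis_def heis_gen_def by (rule presented_group_inv_letter)

lemma gen_comm_word:
  assumes "x \<in> {p, q, r}" "y \<in> {p, q, r}"
  shows "cls (word_comm [(x, True)] [(y, True)]) =
    gen x \<otimes>\<^bsub>H\<^esub> gen y \<otimes>\<^bsub>H\<^esub> inv\<^bsub>H\<^esub> gen x \<otimes>\<^bsub>H\<^esub> inv\<^bsub>H\<^esub> gen y"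
  using assms
  by (simp add: gen_inv word_pair_mult)
    (simp add: heis_def presented_group_mult word_comm_def)

lemma gen_r_commute:
  assumes "x \<in> {p, q}"
  shows "gen x \<otimes>\<^bsub>H\<^esub> gen r = gen r \<otimes>\<^bsub>H\<^esub> gen x"
proof -
  have "cls (word_comm [(x, True)] [(r, True)]) = \<one>\<^bsub>H\<^esub>"
    unfolding heis_def using assms
    by (intro pres_class_relator) (auto simp: heis_rels_def word_comm_def)
  then have "gen x \<otimes>\<^bsub>H\<^esub> gen r \<otimes>\<^bsub>H\<^esub> inv\<^bsub>H\<^esub> gen x \<otimes>\<^bsub>H\<^esub> inv\<^bsub>H\<^esub> gen r = \<one>\<^bsub>H\<^esub>"
    using assms by (subst (asm) gen_comm_word) auto
  then show ?thesis
    using assms gen_closed[of x] gen_closed[of r]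
    by (smt (verit) G.inv_closed G.inv_equality G.inv_inv G.inv_solve_right G.m_closed
        G.inv_solve_right' insert_iff G.l_one)
qed

text \<open>The relator \<open>[p, q] r\<^sup>-\<^sup>1\<close>, in the form \<open>p q p\<^sup>-\<^sup>1 = r q\<close> that fits the intertwining lemma.\<close>

lemma gen_p_gen_q: "gen p \<otimes>\<^bsub>H\<^esub> gen q = (gen r \<otimes>\<^bsub>H\<^esub> gen q) \<otimes>\<^bsub>H\<^esub> gen p"
proof -
  have "cls (word_comm [(p, True)] [(q, True)] @ word_inv [(r, True)]) = \<one>\<^bsub>H\<^esub>"
    unfolding heis_def
    by (intro pres_class_relator) (auto simp: heis_rels_def word_comm_def)
  moreover have "cls (word_comm [(p, True)] [(q, True)] @ word_inv [(r, True)]) =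
      cls (word_comm [(p, True)] [(q, True)]) \<otimes>\<^bsub>H\<^esub> inv\<^bsub>H\<^esub> gen r"
    by (simp add: gen_inv) (simp add: heis_def presented_group_mult word_comm_def)
  ultimately have "gen p \<otimes>\<^bsub>H\<^esub> gen q \<otimes>\<^bsub>H\<^esub> inv\<^bsub>H\<^esub> gen p \<otimes>\<^bsub>H\<^esub> inv\<^bsub>H\<^esub> gen q \<otimes>\<^bsub>H\<^esub> inv\<^bsub>H\<^esub> gen r = \<one>\<^bsub>H\<^esub>"
    by (simp add: gen_comm_word)
  then show ?thesis
    using gen_closed[of p] gen_closed[of q] gen_closed[of r]
    by (smt (verit) G.inv_closed G.inv_equality G.inv_inv G.inv_solve_right G.m_closed
        G.inv_solve_right' insert_iff G.l_one)
qed

lemma hmon_eq: "hmon (i, j, k) = gen p [^]\<^bsub>H\<^esub> i \<otimes>\<^bsub>H\<^esub> gen r [^]\<^bsub>H\<^esub> j \<otimes>\<^bsub>H\<^esub> gen q [^]\<^bsub>H\<^esub> k"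
  by (simp add: heis_monom_def)

lemma hmon_closed [simp]: "hmon m \<in> carrier H"
  by (cases m) (simp add: hmon_eq)

text \<open>The only multiplication that is not immediate. Intertwining gives
  \<open>p q\<^sup>k = (r q)\<^sup>k p = r\<^sup>k q\<^sup>k p\<close>, so \<open>q\<^sup>k p\<close> becomes \<open>p q\<^sup>k\<close> at the price of \<open>r\<close> to the
  power \<open>- k\<close>, which then joins \<open>r\<^sup>j\<close>.\<close>

lemma hmon_mult_gen_p: "hmon (i, j, k) \<otimes>\<^bsub>H\<^esub> gen p = hmon (i + 1, j - k, k)"
proof -
  note [simp] = G.m_assoc G.int_pow_mult G.int_pow_diff
  let ?P = "gen p" and ?Q = "gen q" and ?R = "gen r"
  have R: "?P \<otimes>\<^bsub>H\<^esub> ?R [^]\<^bsub>H\<^esub> n = ?R [^]\<^bsub>H\<^esub> n \<otimes>\<^bsub>H\<^esub> ?P" for n :: int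
    by (intro G.int_pow_intertwine gen_r_commute) auto
  have "?P \<otimes>\<^bsub>H\<^esub> ?Q [^]\<^bsub>H\<^esub> k = (?R \<otimes>\<^bsub>H\<^esub> ?Q) [^]\<^bsub>H\<^esub> k \<otimes>\<^bsub>H\<^esub> ?P"
    by (intro G.int_pow_intertwine gen_p_gen_q) auto
  also have "(?R \<otimes>\<^bsub>H\<^esub> ?Q) [^]\<^bsub>H\<^esub> k = ?R [^]\<^bsub>H\<^esub> k \<otimes>\<^bsub>H\<^esub> ?Q [^]\<^bsub>H\<^esub> k"
    by (intro G.int_pow_mult_distrib gen_r_commute[symmetric]) auto
  finally have PQ: "?P \<otimes>\<^bsub>H\<^esub> ?Q [^]\<^bsub>H\<^esub> k = ?R [^]\<^bsub>H\<^esub> k \<otimes>\<^bsub>H\<^esub> (?Q [^]\<^bsub>H\<^esub> k \<otimes>\<^bsub>H\<^esub> ?P)"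
    by simp
  have "hmon (i + 1, j - k, k) = ?P [^]\<^bsub>H\<^esub> i \<otimes>\<^bsub>H\<^esub> (?P \<otimes>\<^bsub>H\<^esub> ?R [^]\<^bsub>H\<^esub> (j - k)) \<otimes>\<^bsub>H\<^esub> ?Q [^]\<^bsub>H\<^esub> k"
    by (simp add: hmon_eq del: G.int_pow_diff)
  also have "\<dots> = ?P [^]\<^bsub>H\<^esub> i \<otimes>\<^bsub>H\<^esub> ?R [^]\<^bsub>H\<^esub> (j - k) \<otimes>\<^bsub>H\<^esub> (?P \<otimes>\<^bsub>H\<^esub> ?Q [^]\<^bsub>H\<^esub> k)"
    by (subst R) (simp del: G.int_pow_diff)
  also have "\<dots> = ?P [^]\<^bsub>H\<^esub> i \<otimes>\<^bsub>H\<^esub> (?R [^]\<^bsub>H\<^esub> (j - k) \<otimes>\<^bsub>H\<^esub> ?R [^]\<^bsub>H\<^esub> k) \<otimes>\<^bsub>H\<^esub> ?Q [^]\<^bsub>H\<^esub> k \<otimes>\<^bsub>H\<^esub> ?P"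
    by (subst PQ) (simp del: G.int_pow_diff)
  also have "?R [^]\<^bsub>H\<^esub> (j - k) \<otimes>\<^bsub>H\<^esub> ?R [^]\<^bsub>H\<^esub> k = ?R [^]\<^bsub>H\<^esub> j"
    by (simp flip: G.int_pow_mult del: G.int_pow_diff)
  finally show ?thesis by (simp add: hmon_eq)
qed

lemma hmon_mult_gen_q: "hmon (i, j, k) \<otimes>\<^bsub>H\<^esub> gen q = hmon (i, j, k + 1)"
  by (simp add: hmon_eq G.m_assoc G.int_pow_mult)

lemma hmon_mult_gen_r: "hmon (i, j, k) \<otimes>\<^bsub>H\<^esub> gen r = hmon (i, j + 1, k)"
proof -
  have "gen r \<otimes>\<^bsub>H\<^esub> gen q [^]\<^bsub>H\<^esub> k = gen q [^]\<^bsub>H\<^esub> k \<otimes>\<^bsub>H\<^esub> gen r"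
    by (intro G.int_pow_intertwine gen_r_commute[symmetric]) auto
  then show ?thesis
    by (simp add: hmon_eq G.m_assoc G.int_pow_mult)
qed

lemma hmon_mult_gen:
  assumes "x \<in> {p, q, r}"
  shows "hmon m \<otimes>\<^bsub>H\<^esub> gen x = hmon (heis_step p q (x, True) m)"
  using assms distinct_letters
  by (cases m) (auto simp: hmon_mult_gen_p hmon_mult_gen_q hmon_mult_gen_r)

lemma hmon_mult_letter:
  assumes "x \<in> {p, q, r}"
  shows "hmon m \<otimes>\<^bsub>H\<^esub> cls [(x, b)] = hmon (heis_step p q (x, b) m)"
proof (cases b)
  case True
  then show ?thesis using hmon_mult_gen[OF assms] by (simp add: heis_gen_def)
next
  case False
  have "hmon (heis_step p q (x, False) m) \<otimes>\<^bsub>H\<^esub> gen x = hmon m"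
    using heis_step_inverse[of x False m] by (simp add: hmon_mult_gen[OF assms])
  then have "hmon m \<otimes>\<^bsub>H\<^esub> inv\<^bsub>H\<^esub> gen x = hmon (heis_step p q (x, False) m)"
    using assms by (intro G.inv_solve_right'[THEN iffD2]) auto
  then show ?thesis using False by (simp add: gen_inv[OF assms])
qed

lemma hmon_mult_word:
  "w \<in> words {p, q, r} \<Longrightarrow> hmon m \<otimes>\<^bsub>H\<^esub> cls w = hmon (run w m)"
proof (induction w arbitrary: m)
  case Nil
  have "hmon m \<otimes>\<^bsub>H\<^esub> \<one>\<^bsub>H\<^esub> = hmon m" by simp
  then show ?case by (simp add: heis_def one_presented_group)
next
  case (Cons a w)
  obtain x b where a: "a = (x, b)" by (cases a)
  have "cls (a # w) = cls [(x, b)] \<otimes>\<^bsub>H\<^esub> cls w"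
    using Cons.prems a by (simp add: heis_def presented_group_mult)
  moreover have "cls [(x, b)] \<in> carrier H" "cls w \<in> carrier H"
    using Cons.prems a by (auto simp: heis_def carrier_presented_group)
  ultimately have "hmon m \<otimes>\<^bsub>H\<^esub> cls (a # w) = (hmon m \<otimes>\<^bsub>H\<^esub> cls [(x, b)]) \<otimes>\<^bsub>H\<^esub> cls w"
    by (simp add: G.m_assoc)
  then show ?case using Cons a by (simp add: hmon_mult_letter)
qed

lemma cls_eq_hmon: "w \<in> words {p, q, r} \<Longrightarrow> cls w = hmon (run w (0, 0, 0))"
proof -
  assume w: "w \<in> words {p, q, r}"
  then have "cls w \<in> carrier H" by (simp add: heis_def carrier_presented_group)
  moreover have "hmon (0, 0, 0) = \<one>\<^bsub>H\<^esub>" by (simp add: hmon_eq)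
  ultimately show ?thesis using hmon_mult_word[OF w, of "(0, 0, 0)"] by simp
qed

text \<open>Each class of words equals the monomial whose exponents are obtained by running the word from the
  origin, which gives surjectivity. For injectivity take words reaching \<open>m\<close> and \<open>m'\<close>: if their
  monomials agree, the words are congruent, and congruent words reach the same triple.\<close>

theorem hmon_bij: "bij_betw hmon UNIV (carrier H)"
proof (rule bij_betwI')
  fix m m'
  obtain w w' where w: "w \<in> words {p, q, r}" "run w (0, 0, 0) = m"
      "w' \<in> words {p, q, r}" "run w' (0, 0, 0) = m'"
    using run_surj by metis
  show "hmon m = hmon m' \<longleftrightarrow> m = m'"
    using w cls_eq_hmon[of w] cls_eq_hmon[of w'] pres_class_eq_iff run_cong by metis
next
  fix g assume "g \<in> carrier H"
  then show "\<exists>m\<in>UNIV. g = hmon m"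
    using cls_eq_hmon unfolding heis_def carrier_presented_group by blast
qed simp

lemma hmon_eq_iff [simp]: "hmon m = hmon m' \<longleftrightarrow> m = m'"
  using hmon_bij by (metis bij_betw_def inj_eq)

section \<open>Coefficients\<close>

text \<open>Since the monomials enumerate the group without repetition, the coefficients of an expansion are
  the values of \<open>v\<close> at the monomials. Existence and uniqueness of the expansion follow together.\<close>

lemma expands_iff:
  "expands p q r v a \<longleftrightarrow> v \<in> carrier (group_ring H) \<and> a = v \<circ> hmon"
proof
  assume a: "expands p q r v a"
  then have fin: "finite {m. a m \<noteq> 0}" 
    and v: "v = (\<lambda>g. \<Sum>m | a m \<noteq> 0. if g = hmon m then a m else 0)"
    by (auto simp: expands_def)
  have "{g. v g \<noteq> 0} \<subseteq> hmon ` {m. a m \<noteq> 0}"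
  proof (rule subsetI, rule ccontr)
    fix g assume g: "g \<in> {g. v g \<noteq> 0}" "g \<notin> hmon ` {m. a m \<noteq> 0}"
    then have "(\<Sum>m | a m \<noteq> 0. if g = hmon m then a m else 0) = 0"
      by (intro sum.neutral) auto
    with g show False by (simp add: v)
  qed
  moreover have "v (hmon m) = a m" for m
    unfolding v using fin by (simp add: sum.delta)
  ultimately show "v \<in> carrier (group_ring H) \<and> a = v \<circ> hmon"
    using fin by (auto simp: group_ring_def intro: finite_subset)
next
  assume va: "v \<in> carrier (group_ring H) \<and> a = v \<circ> hmon"
  then have fin: "finite {g. v g \<noteq> 0}" and sub: "{g. v g \<noteq> 0} \<subseteq> carrier H"
    by (auto simp: group_ring_def)
  have "finite (hmon -` {g. v g \<noteq> 0})"
    using fin by (rule finite_vimageI) (simp add: inj_on_def)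
  then have fin': "finite {m. a m \<noteq> 0}"
    using va by (simp add: vimage_def)
  have "v g = (\<Sum>m | a m \<noteq> 0. if g = hmon m then a m else 0)" for g
  proof (cases "g \<in> carrier H")
    case True
    then obtain m where "g = hmon m" using hmon_bij by (metis bij_betw_def imageE)
    then show ?thesis using fin' va by (simp add: sum.delta)
  next
    case False
    then have "v g = 0" using sub by auto
    moreover have "g \<noteq> hmon m" for m using False hmon_closed by blast
    ultimately show ?thesis by simp
  qed
  then show "expands p q r v a" using fin' by (auto simp: expands_def)
qed

lemma expands_coeffs:
  "v \<in> carrier (group_ring H) \<Longrightarrow> coeffs_of p q r v = v \<circ> hmon"
  unfolding coeffs_of_def by (auto simp: expands_iff)

text \<open>Shearing permutes the monomials, so it moves the coefficients to the sheared exponents.\<close>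

lemma expands_shear:
  assumes "expands p q r v a"
  shows "expands p q r (shear p q r \<alpha> \<beta> v) (\<lambda>(i, j, k). a (i, j - \<alpha> * i - \<beta> * k, k))"
proof -
  let ?s = "\<lambda>(i, j, k). (i, j + \<alpha> * i + \<beta> * k, k)"
  let ?a = "\<lambda>(i, j, k). a (i, j - \<alpha> * i - \<beta> * k, k)"
  have fin: "finite {m. a m \<noteq> 0}" using assms by (simp add: expands_def)
  have as: "?a (?s m) = a m" for m by (cases m) simp
  have inj: "inj ?s" by (auto simp: inj_on_def)
  have supp: "{m. ?a m \<noteq> 0} = ?s ` {m. a m \<noteq> 0}"
  proof -
    have "m = ?s (case m of (i, j, k) \<Rightarrow> (i, j - \<alpha> * i - \<beta> * k, k))" for m by (cases m) simp
    then show ?thesis using as by (force simp: image_iff)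
  qed
  have "coeffs_of p q r v = a"
    using assms expands_coeffs by (auto simp: expands_iff)
  then have "shear p q r \<alpha> \<beta> v = (\<lambda>g. \<Sum>m | a m \<noteq> 0. if g = hmon (?s m) then a m else 0)"
    unfolding shear_def Let_def by (auto intro!: ext sum.cong split: prod.splits)
  also have "\<dots> = (\<lambda>g. \<Sum>m | ?a m \<noteq> 0. if g = hmon m then ?a m else 0)"
    unfolding supp using inj as
    by (intro ext) (subst sum.reindex, auto intro: inj_on_subset intro!: sum.cong split: prod.splits)
  finally show ?thesis
    using fin supp by (auto simp: expands_def)
qed

end

section \<open>Affine subsets and their rank\<close>

text \<open>Gaussian elimination without division: one unknown \<open>z\<close> with nonzero coefficient in the last equation is
  eliminated from the others by cross-multiplication, which keeps everything integral.\<close>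

lemma nontrivial_int_relation:
  fixes f :: "nat \<Rightarrow> 'a \<Rightarrow> int"
  assumes "finite A" "m < card A"
  shows "\<exists>c. (\<exists>a\<in>A. c a \<noteq> 0) \<and> (\<forall>j<m. (\<Sum>a\<in>A. c a * f j a) = 0)"
  using assms
proof (induction m arbitrary: A f)
  case 0
  then have "A \<noteq> {}" by auto
  then show ?case by (intro exI[of _ "\<lambda>_. 1"]) auto
next
  case (Suc m)
  show ?case
  proof (cases "\<forall>a\<in>A. f m a = 0")
    case True
    obtain c where "\<exists>a\<in>A. c a \<noteq> 0" "\<forall>j<m. (\<Sum>a\<in>A. c a * f j a) = 0"
      using Suc.IH[of A f] Suc.prems by auto
    with True show ?thesis by (intro exI[of _ c]) (auto simp: less_Suc_eq)
  next
    case False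
    then obtain z where z: "z \<in> A" "f m z \<noteq> 0" by blast
    \<comment> \<open>the forms left over after elimination of \<open>z\<close>; the last one becomes \<open>0\<close>\<close>
    define g where "g j a = f m z * f j a - f m a * f j z" for j a
    have "finite (A - {z})" "m < card (A - {z})"
      using Suc.prems z by auto
    from Suc.IH[OF this, of g] obtain c where
      c: "\<exists>a\<in>A - {z}. c a \<noteq> 0" "\<forall>j<m. (\<Sum>a\<in>A - {z}. c a * g j a) = 0" by blast
    \<comment> \<open>scaling by \<open>f m z\<close> makes the value at \<open>z\<close> an integer\<close>
    define d where "d a = (if a = z then - (\<Sum>a\<in>A - {z}. c a * f m a) else c a * f m z)" for a
    have d: "(\<Sum>a\<in>A. d a * f j a) = (\<Sum>a\<in>A - {z}. c a * g j a)" for j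
    proof -
      have "(\<Sum>a\<in>A. d a * f j a) = d z * f j z + (\<Sum>a\<in>A - {z}. d a * f j a)"
        using Suc.prems z by (intro sum.remove) auto
      also have "(\<Sum>a\<in>A - {z}. d a * f j a) = (\<Sum>a\<in>A - {z}. c a * f m z * f j a)"
        by (intro sum.cong) (auto simp: d_def)
      also have "d z * f j z = (\<Sum>a\<in>A - {z}. - (c a * f m a * f j z))"
        by (simp add: d_def sum_distrib_right sum_negf)
      finally show ?thesis
        by (simp add: g_def algebra_simps flip: sum.distrib)
    qed
    have "(\<Sum>a\<in>A. d a * f j a) = 0" if "j < Suc m" for j
    proof (cases "j = m")
      case True
      then show ?thesis by (simp add: d g_def)
    next
      case False
      with that c(2) show ?thesis by (simp add: d)
    qed
    moreover have "\<exists>a\<in>A. d a \<noteq> 0"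
      using c(1) z by (auto simp: d_def)
    ultimately show ?thesis by blast
  qed
qed

abbreviation lin_dep_Z :: "nat \<Rightarrow> int vec set \<Rightarrow> bool" where
  "lin_dep_Z n \<equiv> LinearCombinations.module.lin_dep class_ring (Zmod n)"

text \<open>Turns linear dependence into identities between finite sums of integers, on which elimination
  and reindexing of coordinates act directly.\<close>

lemma lin_dep_Z_iff:
  assumes "B \<subseteq> carrier_vec n"
  shows "lin_dep_Z n B \<longleftrightarrow>
    (\<exists>A c. finite A \<and> A \<subseteq> B \<and> (\<exists>x\<in>A. c x \<noteq> 0) \<and> (\<forall>i<n. (\<Sum>x\<in>A. c x * x $ i) = 0))"
proof -
  interpret vec_module "TYPE(int)" n .
  have lincomb_zero: "lincomb c A = 0\<^sub>v n \<longleftrightarrow> (\<forall>i<n. (\<Sum>x\<in>A. c x * x $ i) = 0)"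
    if "A \<subseteq> B" for A and c :: "int vec \<Rightarrow> int"
  proof -
    have A: "A \<subseteq> carrier_vec n" using that assms by blast
    have index: "lincomb c A $ i = (\<Sum>x\<in>A. c x * x $ i)" if i: "i < n" for i
    proof -
      have "(c x \<cdot>\<^sub>v x) $ i = c x * x $ i" if "x \<in> A" for x
        using that A i by (subst index_smult_vec(1)) auto
      then show ?thesis
        unfolding lincomb_def using A by (subst finsum_index[OF i]) (auto intro!: sum.cong)
    qed
    have "lincomb c A \<in> carrier_vec n" using A by (rule lincomb_closed)
    then have dim: "dim_vec (lincomb c A) = n" by (rule carrier_vecD)
    show ?thesis
    proof
      assume "lincomb c A = 0\<^sub>v n"
      then show "\<forall>i<n. (\<Sum>x\<in>A. c x * x $ i) = 0" by (simp flip: index)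
    next
      assume "\<forall>i<n. (\<Sum>x\<in>A. c x * x $ i) = 0"
      then show "lincomb c A = 0\<^sub>v n" by (intro eq_vecI) (simp_all add: index dim)
    qed
  qed
  show ?thesis
  proof
    assume "lin_dep_Z n B"
    then obtain A c x where "finite A" "A \<subseteq> B" "lincomb c A = 0\<^sub>v n" "x \<in> A" "c x \<noteq> 0"
      unfolding lin_dep_def by blast
    then show "\<exists>A c. finite A \<and> A \<subseteq> B \<and> (\<exists>x\<in>A. c x \<noteq> 0) \<and> (\<forall>i<n. (\<Sum>x\<in>A. c x * x $ i) = 0)"
      using lincomb_zero by blast
  next
    assume "\<exists>A c. finite A \<and> A \<subseteq> B \<and> (\<exists>x\<in>A. c x \<noteq> 0) \<and> (\<forall>i<n. (\<Sum>x\<in>A. c x * x $ i) = 0)"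
    then obtain A c x where "finite A" "A \<subseteq> B" "lincomb c A = 0\<^sub>v n" "x \<in> A" "c x \<noteq> 0"
      using lincomb_zero by blast
    then show "lin_dep_Z n B" unfolding lin_dep_def by blast
  qed
qed

text \<open>More than \<open>m\<close> elements of \<open>N\<close> have coefficient columns of length \<open>m\<close>, and these satisfy a
  nontrivial relation, which the elements inherit. This bound is also what makes the
  greatest element in the definition of the rank meaningful.\<close>

lemma Zrank_le:
  fixes v :: "nat \<Rightarrow> nat \<Rightarrow> int"
  assumes N: "N \<subseteq> carrier_vec n"
    and gen: "\<And>x. x \<in> N \<Longrightarrow> \<exists>q. \<forall>i<n. x $ i = (\<Sum>j<m. q j * v j i)"
  shows "Zrank n N \<le> m"
proof -
  have dep: "lin_dep_Z n B" if B: "B \<subseteq> N" "finite B" "m < card B" for B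
  proof -
    obtain q where q: "\<And>x i. x \<in> N \<Longrightarrow> i < n \<Longrightarrow> x $ i = (\<Sum>j<m. q x j * v j i)"
      using gen by metis
    obtain c where c: "\<exists>x\<in>B. c x \<noteq> 0" "\<forall>j<m. (\<Sum>x\<in>B. c x * q x j) = 0"
      using nontrivial_int_relation[OF B(2,3), of "\<lambda>j x. q x j"] by blast
    have "(\<Sum>x\<in>B. c x * x $ i) = 0" if i: "i < n" for i
    proof -
      have "(\<Sum>x\<in>B. c x * x $ i) = (\<Sum>x\<in>B. c x * (\<Sum>j<m. q x j * v j i))"
        using B q i by (intro sum.cong) auto
      also have "\<dots> = (\<Sum>j<m. (\<Sum>x\<in>B. c x * q x j) * v j i)"
        by (subst sum_distrib_left, subst sum.swap) (simp add: sum_distrib_right mult.assoc)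
      also have "\<dots> = 0" using c by simp
      finally show ?thesis .
    qed
    moreover have "B \<subseteq> carrier_vec n" using B N by blast
    ultimately show ?thesis using c B by (subst lin_dep_Z_iff) blast+
  qed
  let ?P = "\<lambda>k. \<exists>B\<subseteq>N. finite B \<and> card B = k \<and> \<not> lin_dep_Z n B"
  have bound: "k \<le> m" if "?P k" for k
    using that dep by (meson not_le)
  have "?P 0" by (intro exI[of _ "{}"]) (simp add: lin_dep_Z_iff)
  then have "?P (GREATEST k. ?P k)"
    using bound by (rule GreatestI_nat)
  then show ?thesis unfolding Zrank_def by (rule bound)
qed

lemma submodule_closed:
  assumes "LinearCombinations.submodule class_ring N (Zmod n)"
  shows "N \<subseteq> carrier_vec n" "0\<^sub>v n \<in> N" "\<And>x y. x \<in> N \<Longrightarrow> y \<in> N \<Longrightarrow> x + y \<in> N"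
    "\<And>x (c :: int). x \<in> N \<Longrightarrow> c \<cdot>\<^sub>v x \<in> N"
  using LinearCombinations.submodule.subset[OF assms]
    LinearCombinations.submodule.zero_closed[OF assms]
    LinearCombinations.submodule.m_closed[OF assms]
    LinearCombinations.submodule.smult_closed[OF assms]
  by (auto simp: module_vec_simps)

lemma submoduleI:
  assumes "N \<subseteq> carrier_vec n" "0\<^sub>v n \<in> N" "\<And>x y. x \<in> N \<Longrightarrow> y \<in> N \<Longrightarrow> x + y \<in> N"
    "\<And>x (c :: int). x \<in> N \<Longrightarrow> c \<cdot>\<^sub>v x \<in> N"
  shows "LinearCombinations.submodule class_ring N (Zmod n)"
proof -
  interpret vec_module "TYPE(int)" n .
  show ?thesis
    using assms by (intro LinearCombinations.submodule.intro module_axioms) (auto simp: module_vec_simps)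
qed

text \<open>A coset determines its submodule as the set of differences of its points.\<close>

lemma coset_determines_submodule:
  fixes x x' :: "int vec"
  assumes N: "LinearCombinations.submodule class_ring N (Zmod n)"
    and N': "LinearCombinations.submodule class_ring N' (Zmod n)"
    and x: "x \<in> carrier_vec n" "x' \<in> carrier_vec n"
    and eq: "{x + y | y. y \<in> N} = {x' + y | y. y \<in> N'}"
  shows "N \<subseteq> N'"
proof
  fix y assume y: "y \<in> N"
  note cl = submodule_closed[OF N] and cl' = submodule_closed[OF N']
  have "x + 0\<^sub>v n \<in> {x' + y | y. y \<in> N'}" "x + y \<in> {x' + y | y. y \<in> N'}"
    using cl(2) y by (auto simp flip: eq)
  then obtain a b where ab: "a \<in> N'" "x + 0\<^sub>v n = x' + a" "b \<in> N'" "x + y = x' + b" by blast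
  have c: "y \<in> carrier_vec n" "a \<in> carrier_vec n" "b \<in> carrier_vec n"
    using cl(1) cl'(1) y ab by auto
  have "y = b + (- 1) \<cdot>\<^sub>v a"
  proof (rule eq_vecI)
    fix i assume "i < dim_vec (b + (- 1) \<cdot>\<^sub>v a)"
    then have i: "i < n" using c by simp
    have "(x + 0\<^sub>v n) $ i = (x' + a) $ i" "(x + y) $ i = (x' + b) $ i" using ab by simp_all
    then show "y $ i = (b + (- 1) \<cdot>\<^sub>v a) $ i" using i c x by simp
  qed (use c in simp)
  then show "y \<in> N'" using cl'(3,4) ab by simp
qed

lemma affine_sets_rank_unique:
  assumes "A \<in> affine_sets k n" "A \<in> affine_sets k' n"
  shows "k = k'"
proof -
  obtain x N where 1: "A = {x + y | y. y \<in> N}" "x \<in> carrier_vec n"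
      "LinearCombinations.submodule class_ring N (Zmod n)" "Zrank n N = k"
    using assms(1) unfolding affine_sets_def by blast
  obtain x' N' where 2: "A = {x' + y | y. y \<in> N'}" "x' \<in> carrier_vec n"
      "LinearCombinations.submodule class_ring N' (Zmod n)" "Zrank n N' = k'"
    using assms(2) unfolding affine_sets_def by blast
  have "N = N'"
    using coset_determines_submodule[OF 1(3) 2(3) 1(2) 2(2)]
      coset_determines_submodule[OF 2(3) 1(3) 2(2) 1(2)] 1(1) 2(1) by auto
  with 1 2 show ?thesis by simp
qed

text \<open>Permuting coordinates, described without matrices. When \<open>\<gamma>\<close> is a permutation of the indices
  below \<open>n\<close>, this is linear and invertible, so it preserves linear independence, rank, submodules
  and affine subsets.\<close>

definition reindex_vec :: "nat \<Rightarrow> (nat \<Rightarrow> nat) \<Rightarrow> int vec \<Rightarrow> int vec" where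
  "reindex_vec n \<gamma> x = vec n (\<lambda>r. x $ \<gamma> r)"

lemma reindex_vec_carrier [simp]: "reindex_vec n \<gamma> x \<in> carrier_vec n"
  by (simp add: reindex_vec_def)

lemma index_reindex_vec: "r < n \<Longrightarrow> reindex_vec n \<gamma> x $ r = x $ \<gamma> r"
  by (simp add: reindex_vec_def)

lemma reindex_vec_inverse:
  assumes "\<gamma> permutes {..<n}" "x \<in> carrier_vec n"
  shows "reindex_vec n (inv_into UNIV \<gamma>) (reindex_vec n \<gamma> x) = x"
proof (rule eq_vecI)
  fix r assume "r < dim_vec x"
  then have r: "r < n" using assms(2) by auto
  then have "inv_into UNIV \<gamma> r < n"
    using permutes_in_image[OF permutes_inv[OF assms(1)], of r] by simp
  with r show "reindex_vec n (inv_into UNIV \<gamma>) (reindex_vec n \<gamma> x) $ r = x $ r"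
    by (simp add: index_reindex_vec permutes_inverses[OF assms(1)])
qed (use assms(2) in \<open>simp add: reindex_vec_def\<close>)

lemma reindex_vec_inj_on:
  assumes "\<gamma> permutes {..<n}"
  shows "inj_on (reindex_vec n \<gamma>) (carrier_vec n)"
  using reindex_vec_inverse[OF assms] by (rule inj_on_inverseI)

text \<open>Coordinate \<open>i\<close> of a relation among the \<open>x\<close> is coordinate \<open>\<gamma>\<^sup>-\<^sup>1 i\<close> of the same relation among
  the reindexed vectors.\<close>

lemma lin_dep_Z_reindex:
  assumes \<gamma>: "\<gamma> permutes {..<n}" and B: "B \<subseteq> carrier_vec n"
    and dep: "lin_dep_Z n (reindex_vec n \<gamma> ` B)"
  shows "lin_dep_Z n B"
proof -
  let ?f = "reindex_vec n \<gamma>"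
  have "?f ` B \<subseteq> carrier_vec n" by auto
  from dep[unfolded lin_dep_Z_iff[OF this]] obtain A c where
    A: "finite A" "A \<subseteq> ?f ` B" "\<exists>y\<in>A. c y \<noteq> 0" "\<forall>i<n. (\<Sum>y\<in>A. c y * y $ i) = 0" by blast
  obtain A' where A': "A' \<subseteq> B" "inj_on ?f A'" "A = ?f ` A'"
    using A(2) unfolding subset_image_inj by blast
  have "(\<Sum>x\<in>A'. c (?f x) * x $ i) = 0" if i: "i < n" for i
  proof -
    have inv: "inv_into UNIV \<gamma> i < n"
      using permutes_in_image[OF permutes_inv[OF \<gamma>], of i] i by simp
    then have "(\<Sum>y\<in>A. c y * y $ inv_into UNIV \<gamma> i) = 0" using A(4) by blast
    then show ?thesis
      using inv by (simp add: A'(3) sum.reindex[OF A'(2)] index_reindex_vec permutes_inverses[OF \<gamma>])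
  qed
  moreover have "finite A'" using A(1) A'(2,3) finite_imageD by blast
  moreover have "\<exists>x\<in>A'. c (?f x) \<noteq> 0" using A(3) A'(3) by blast
  ultimately show ?thesis
    unfolding lin_dep_Z_iff[OF B] using A'(1) by (intro exI[of _ A'] exI[of _ "c \<circ> ?f"]) simp
qed

lemma Zrank_reindex:
  assumes \<gamma>: "\<gamma> permutes {..<n}" and N: "N \<subseteq> carrier_vec n"
  shows "Zrank n (reindex_vec n \<gamma> ` N) = Zrank n N"
proof -
  let ?P = "\<lambda>N k. \<exists>B\<subseteq>N. finite B \<and> card B = k \<and> \<not> lin_dep_Z n B"
  \<comment> \<open>stated for every permutation, so that the inverse permutation gives the converse\<close>
  have mono: "?P (reindex_vec n \<delta> ` N') k"
    if \<delta>: "\<delta> permutes {..<n}" and N': "N' \<subseteq> carrier_vec n" and P: "?P N' k" for \<delta> N' k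
  proof -
    obtain B where B: "B \<subseteq> N'" "finite B" "card B = k" "\<not> lin_dep_Z n B" using P by blast
    have Bc: "B \<subseteq> carrier_vec n" using B(1) N' by blast
    have "card (reindex_vec n \<delta> ` B) = k"
      using B(3) inj_on_subset[OF reindex_vec_inj_on[OF \<delta>] Bc] by (simp add: card_image)
    moreover have "\<not> lin_dep_Z n (reindex_vec n \<delta> ` B)"
      using B(4) lin_dep_Z_reindex[OF \<delta> Bc] by blast
    ultimately show ?thesis using B(1,2) by (intro exI[of _ "reindex_vec n \<delta> ` B"]) auto
  qed
  have "reindex_vec n (inv_into UNIV \<gamma>) (reindex_vec n \<gamma> x) = x" if "x \<in> N" for x
    using that N reindex_vec_inverse[OF \<gamma>] by blast
  then have undo: "reindex_vec n (inv_into UNIV \<gamma>) ` reindex_vec n \<gamma> ` N = N"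
    by (simp add: image_image)
  have "?P N k \<longleftrightarrow> ?P (reindex_vec n \<gamma> ` N) k" for k
  proof
    have "reindex_vec n \<gamma> ` N \<subseteq> carrier_vec n" by auto
    from mono[OF permutes_inv[OF \<gamma>] this, of k, unfolded undo]
    show "?P (reindex_vec n \<gamma> ` N) k \<Longrightarrow> ?P N k" .
  qed (rule mono[OF \<gamma> N])
  then show ?thesis unfolding Zrank_def by presburger
qed

lemma affine_sets_reindex:
  assumes \<gamma>: "\<gamma> permutes {..<n}" and A: "A \<in> affine_sets k n"
  shows "reindex_vec n \<gamma> ` A \<in> affine_sets k n"
proof -
  let ?f = "reindex_vec n \<gamma>"
  obtain x N where xN: "A = {x + y | y. y \<in> N}" "x \<in> carrier_vec n"
      "LinearCombinations.submodule class_ring N (Zmod n)" "Zrank n N = k"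
    using A unfolding affine_sets_def by blast
  note cl = submodule_closed[OF xN(3)]
  have \<gamma>_lt: "\<gamma> r < n" if "r < n" for r
    using permutes_in_image[OF \<gamma>, of r] that by simp
  have add: "?f (y + z) = ?f y + ?f z" if "y \<in> carrier_vec n" "z \<in> carrier_vec n" for y z
    using that by (intro eq_vecI) (auto simp: reindex_vec_def \<gamma>_lt)
  have smult: "?f (s \<cdot>\<^sub>v y) = s \<cdot>\<^sub>v ?f y" if "y \<in> carrier_vec n" for s y
    using that by (intro eq_vecI) (auto simp: reindex_vec_def \<gamma>_lt)
  have zero: "?f (0\<^sub>v n) = 0\<^sub>v n"
    by (intro eq_vecI) (auto simp: reindex_vec_def \<gamma>_lt)
  have "LinearCombinations.submodule class_ring (?f ` N) (Zmod n)"
  proof (rule submoduleI)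
    show "?f ` N \<subseteq> carrier_vec n" by auto
    show "0\<^sub>v n \<in> ?f ` N" using cl(2) zero by (metis imageI)
    show "y + z \<in> ?f ` N" if "y \<in> ?f ` N" "z \<in> ?f ` N" for y z
    proof -
      obtain y' z' where yz: "y' \<in> N" "z' \<in> N" "y = ?f y'" "z = ?f z'" using \<open>y \<in> ?f ` N\<close> \<open>z \<in> ?f ` N\<close> by blast
      moreover have "?f (y' + z') = ?f y' + ?f z'" using yz(1,2) cl(1) by (intro add) auto
      ultimately have "y + z = ?f (y' + z')" by simp
      then show ?thesis using cl(3) yz by blast
    qed
    show "s \<cdot>\<^sub>v y \<in> ?f ` N" if "y \<in> ?f ` N" for s y
    proof -
      obtain y' where y: "y' \<in> N" "y = ?f y'" using \<open>y \<in> ?f ` N\<close> by blast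
      moreover have "?f (s \<cdot>\<^sub>v y') = s \<cdot>\<^sub>v ?f y'" using y(1) cl(1) by (intro smult) auto
      ultimately have "s \<cdot>\<^sub>v y = ?f (s \<cdot>\<^sub>v y')" by simp
      then show ?thesis using cl(4) y by blast
    qed
  qed
  moreover have "Zrank n (?f ` N) = k" using Zrank_reindex[OF \<gamma> cl(1)] xN(4) by simp
  moreover have "?f ` A = {?f x + y | y. y \<in> ?f ` N}"
  proof -
    have "?f (x + y) = ?f x + ?f y" if "y \<in> N" for y using that cl(1) xN(2) by (intro add) auto
    then show ?thesis unfolding xN(1) by (auto simp: image_iff) metis+
  qed
  ultimately show ?thesis
    unfolding affine_sets_def using reindex_vec_carrier by blast
qed

section \<open>Block permutations\<close>

text \<open>Vectors written as lists of pairs, so that a permutation of the \<open>\<int>\<^sup>2\<close> factors is a permutation of the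
  list entries.\<close>

definition pairs_vec :: "(int \<times> int) list \<Rightarrow> int vec" where
  "pairs_vec P = vec_of_list (concat (map (\<lambda>(x, y). [x, y]) P))"

lemma length_concat_pairs: "length (concat (map (\<lambda>(x, y). [x, y]) P)) = 2 * length P"
  by (induction P) auto

lemma dim_pairs_vec [simp]: "dim_vec (pairs_vec P) = 2 * length P"
  by (simp only: pairs_vec_def dim_vec_of_list length_concat_pairs)

lemma pairs_vec_carrier [simp]: "length P = N \<Longrightarrow> pairs_vec P \<in> carrier_vec (2 * N)"
  by (intro carrier_vecI) simp

lemma index_pairs_vec:
  "i < 2 * length P \<Longrightarrow> pairs_vec P $ i = (if even i then fst else snd) (P ! (i div 2))"
proof -
  have "i < 2 * length P \<Longrightarrow> concat (map (\<lambda>(x, y). [x, y]) P) ! i =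
      (if even i then fst else snd) (P ! (i div 2))"
  proof (induction P arbitrary: i)
    case (Cons p P)
    show ?case
    proof (cases "i < 2")
      case True
      then have "i = 0 \<or> i = 1" by linarith
      then show ?thesis by (cases p) auto
    next
      case False
      define k where "k = i - 2"
      with False have i: "i = Suc (Suc k)" by simp
      obtain x y where "p = (x, y)" by (cases p)
      moreover have "k < 2 * length P" using Cons.prems i by simp
      ultimately show ?thesis using Cons.IH[of k] i by simp
    qed
  qed simp
  then show "i < 2 * length P \<Longrightarrow> ?thesis"
    by (simp add: pairs_vec_def vec_of_list_index)
qed

lemma pair_perm_mat_carrier [simp]: "pair_perm_mat n \<pi> \<in> carrier_mat n n"
  by (simp add: pair_perm_mat_def)

text \<open>The column of the matrix with a nonzero entry in row \<open>r\<close> belongs to the factor that \<open>\<pi>\<close> sends to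
  factor \<open>r div 2\<close>, hence the inverse of \<open>\<pi>\<close>.\<close>

lemma pair_perm_mat_mult_vec:
  assumes \<pi>: "\<pi> permutes {..<N}" and x: "x \<in> carrier_vec (2 * N)"
  shows "pair_perm_mat (2 * N) \<pi> *\<^sub>v x = vec (2 * N) (\<lambda>r. x $ (2 * inv_into UNIV \<pi> (r div 2) + r mod 2))"
proof (rule eq_vecI)
  fix r assume "r < dim_vec (vec (2 * N) (\<lambda>r. x $ (2 * inv_into UNIV \<pi> (r div 2) + r mod 2)))"
  then have r: "r < 2 * N" by simp
  define c where "c = 2 * inv_into UNIV \<pi> (r div 2) + r mod 2"
  have "inv_into UNIV \<pi> (r div 2) < N"
    using permutes_in_image[OF permutes_inv[OF \<pi>], of "r div 2"] r by auto
  then have c: "c < 2 * N" unfolding c_def by linarith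
  have iff: "r div 2 = \<pi> (l div 2) \<and> r mod 2 = l mod 2 \<longleftrightarrow> l = c" for l
  proof
    assume lr: "r div 2 = \<pi> (l div 2) \<and> r mod 2 = l mod 2"
    then have "inv_into UNIV \<pi> (r div 2) = l div 2"
      by (simp only: permutes_inverses[OF \<pi>])
    with lr have "c = 2 * (l div 2) + l mod 2" by (simp only: c_def)
    then show "l = c" by simp
  next
    assume "l = c"
    then have "l div 2 = inv_into UNIV \<pi> (r div 2)" "l mod 2 = r mod 2"
      by (simp_all add: c_def)
    then show "r div 2 = \<pi> (l div 2) \<and> r mod 2 = l mod 2"
      by (simp only: permutes_inverses[OF \<pi>])
  qed
  have "(pair_perm_mat (2 * N) \<pi> *\<^sub>v x) $ r =
      (\<Sum>l = 0..<2 * N. pair_perm_mat (2 * N) \<pi> $$ (r, l) * x $ l)"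
    using r x carrier_matD[OF pair_perm_mat_carrier[of "2 * N" \<pi>]] by (simp add: scalar_prod_def)
  also have "\<dots> = (\<Sum>l = 0..<2 * N. if l = c then x $ l else 0)"
  proof (rule sum.cong)
    fix l assume "l \<in> {0..<2 * N}"
    then have l: "l < 2 * N" by simp
    have "pair_perm_mat (2 * N) \<pi> $$ (r, l) = (if l = c then 1 else 0)"
      unfolding pair_perm_mat_def index_mat(1)[OF r l] prod.case iff by (rule refl)
    then show "pair_perm_mat (2 * N) \<pi> $$ (r, l) * x $ l = (if l = c then x $ l else 0)"
      by simp
  qed simp
  also have "\<dots> = x $ c"
    using c by simp
  finally show "(pair_perm_mat (2 * N) \<pi> *\<^sub>v x) $ r =
      vec (2 * N) (\<lambda>r. x $ (2 * inv_into UNIV \<pi> (r div 2) + r mod 2)) $ r"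
    by (simp only: index_vec[OF r] c_def)
qed (simp only: dim_mult_mat_vec dim_vec carrier_matD[OF pair_perm_mat_carrier])

lemma pair_index_permutes:
  assumes \<pi>: "\<pi> permutes {..<N}"
  shows "(\<lambda>r. 2 * \<pi> (r div 2) + r mod 2) permutes {..<2 * N :: nat}"
proof -
  let ?g = "\<lambda>\<pi> r. 2 * \<pi> (r div 2) + r mod 2 :: nat"
  have halves: "(2 * x + r mod 2) div 2 = x" "(2 * x + r mod 2) mod 2 = r mod 2" for x r :: nat
    by simp_all
  have "?g \<pi> \<circ> ?g (inv_into UNIV \<pi>) = id" "?g (inv_into UNIV \<pi>) \<circ> ?g \<pi> = id"
    by (simp_all only: fun_eq_iff o_apply id_apply halves permutes_inverses[OF \<pi>] mult_div_mod_eq simp_thms)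
  then have "bij (?g \<pi>)" by (intro o_bij[of "?g (inv_into UNIV \<pi>)"])
  moreover have "?g \<pi> r = r" if "r \<notin> {..<2 * N}" for r
  proof -
    have "r div 2 \<notin> {..<N}" using that by auto
    then have "\<pi> (r div 2) = r div 2" by (rule permutes_not_in[OF \<pi>])
    then show ?thesis by (simp only: mult_div_mod_eq)
  qed
  ultimately show ?thesis unfolding permutes_def bij_iff by blast
qed

text \<open>Needed for well-definedness of the tag \<open>k\<close>: two orderings of the coefficients may produce
  different affine subsets, and these must have the same rank.\<close>

lemma mat_act_affine_sets:
  assumes \<pi>: "\<pi> permutes {..<N}" and A: "A \<in> affine_sets k (2 * N)"
  shows "mat_act (pair_perm_mat (2 * N) \<pi>) A \<in> affine_sets k (2 * N)"
proof -
  have "A \<subseteq> carrier_vec (2 * N)"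
    using A submodule_closed(1) unfolding affine_sets_def by fastforce
  then have "mat_act (pair_perm_mat (2 * N) \<pi>) A =
      reindex_vec (2 * N) (\<lambda>r. 2 * inv_into UNIV \<pi> (r div 2) + r mod 2) ` A"
    unfolding mat_act_def reindex_vec_def using pair_perm_mat_mult_vec[OF \<pi>]
    by (intro image_cong) auto
  then show ?thesis
    using affine_sets_reindex[OF pair_index_permutes[OF permutes_inv[OF \<pi>]] A] by simp
qed

lemma pair_perm_mat_pairs_vec:
  assumes \<pi>: "\<pi> permutes {..<length P}"
  shows "pair_perm_mat (2 * length P) \<pi> *\<^sub>v pairs_vec (permute_list \<pi> P) = pairs_vec P"
proof (rule eq_vecI)
  fix r assume "r < dim_vec (pairs_vec P)"
  then have r: "r < 2 * length P" by simp
  have l: "inv_into UNIV \<pi> (r div 2) < length P"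
    using permutes_in_image[OF permutes_inv[OF \<pi>], of "r div 2"] r by auto
  have "2 * inv_into UNIV \<pi> (r div 2) + r mod 2 < 2 * length P"
    using l by linarith
  then have "pairs_vec (permute_list \<pi> P) $ (2 * inv_into UNIV \<pi> (r div 2) + r mod 2) =
      (if even r then fst else snd) (P ! (r div 2))"
    using l by (simp add: index_pairs_vec permute_list_nth[OF \<pi>] permutes_inverses[OF \<pi>])
  then show "(pair_perm_mat (2 * length P) \<pi> *\<^sub>v pairs_vec (permute_list \<pi> P)) $ r = pairs_vec P $ r"
    unfolding pair_perm_mat_mult_vec[OF \<pi> pairs_vec_carrier[OF length_permute_list]] index_vec[OF r]
    by (simp only: index_pairs_vec[OF r])
qed (simp only: dim_mult_mat_vec dim_pairs_vec carrier_matD[OF pair_perm_mat_carrier])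

lemma mat_act_comp:
  assumes \<pi>: "\<pi> permutes {..<N}" and \<pi>': "\<pi>' permutes {..<N}" and A: "A \<subseteq> carrier_vec (2 * N)"
  shows "mat_act (pair_perm_mat (2 * N) \<pi>) (mat_act (pair_perm_mat (2 * N) \<pi>') A) =
    mat_act (pair_perm_mat (2 * N) (\<pi> \<circ> \<pi>')) A"
proof -
  have "pair_perm_mat (2 * N) \<pi> *\<^sub>v (pair_perm_mat (2 * N) \<pi>' *\<^sub>v x) =
      pair_perm_mat (2 * N) (\<pi> \<circ> \<pi>') *\<^sub>v x" if "x \<in> A" for x
  proof -
    have x: "x \<in> carrier_vec (2 * N)" using that A by blast
    have "2 * inv_into UNIV \<pi> (r div 2) + r mod 2 < 2 * N" if "r < 2 * N" for r
    proof -
      have "inv_into UNIV \<pi> (r div 2) < N"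
        using permutes_in_image[OF permutes_inv[OF \<pi>], of "r div 2"] that by auto
      then show ?thesis by linarith
    qed
    moreover have "inv_into UNIV (\<pi> \<circ> \<pi>') = inv_into UNIV \<pi>' \<circ> inv_into UNIV \<pi>"
      using \<pi> \<pi>' by (intro o_inv_distrib permutes_bij)
    ultimately show ?thesis
      unfolding pair_perm_mat_mult_vec[OF \<pi>' x] pair_perm_mat_mult_vec[OF \<pi> vec_carrier]
        pair_perm_mat_mult_vec[OF permutes_compose[OF \<pi>' \<pi>] x]
      by (intro eq_vecI) simp_all
  qed
  then show ?thesis unfolding mat_act_def image_image by (intro image_cong refl)
qed

lemma block_perm_comp:
  assumes "\<sigma> permutes {..<n1}" "\<tau> permutes {..<n2}" "\<rho> permutes {..<n3}"
  shows "block_perm (n1, n2, n3) \<sigma>' \<tau>' \<rho>' \<circ> block_perm (n1, n2, n3) \<sigma> \<tau> \<rho> =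
    block_perm (n1, n2, n3) (\<sigma>' \<circ> \<sigma>) (\<tau>' \<circ> \<tau>) (\<rho>' \<circ> \<rho>)"
proof
  fix l
  have "\<sigma> i < n1 \<longleftrightarrow> i < n1" "\<tau> i < n2 \<longleftrightarrow> i < n2" for i
    using permutes_in_image[OF assms(1)] permutes_in_image[OF assms(2)] by auto
  moreover have "n1 \<le> l \<Longrightarrow> l < n1 + n2 \<Longrightarrow> l - n1 < n2" by linarith
  ultimately show "(block_perm (n1, n2, n3) \<sigma>' \<tau>' \<rho>' \<circ> block_perm (n1, n2, n3) \<sigma> \<tau> \<rho>) l =
      block_perm (n1, n2, n3) (\<sigma>' \<circ> \<sigma>) (\<tau>' \<circ> \<tau>) (\<rho>' \<circ> \<rho>) l"
    by (auto simp: block_perm_def)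
qed

lemma block_perm_permutes:
  assumes "\<sigma> permutes {..<n1}" "\<tau> permutes {..<n2}" "\<rho> permutes {..<n3}"
  shows "block_perm (n1, n2, n3) \<sigma> \<tau> \<rho> permutes {..<n1 + n2 + n3}"
proof -
  let ?p = "block_perm (n1, n2, n3) \<sigma> \<tau> \<rho>"
  let ?q = "block_perm (n1, n2, n3) (inv_into UNIV \<sigma>) (inv_into UNIV \<tau>) (inv_into UNIV \<rho>)"
  have id: "block_perm (n1, n2, n3) id id id = id"
    by (auto simp: block_perm_def fun_eq_iff)
  have "?p \<circ> ?q = id" "?q \<circ> ?p = id"
    using assms by (simp_all add: block_perm_comp permutes_inv permutes_inv_o id)
  then have "bij ?p" by (metis o_bij)
  moreover have "?p l = l" if "l \<notin> {..<n1 + n2 + n3}" for l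
    using that permutes_not_in[OF assms(3), of "l - n1 - n2"] by (auto simp: block_perm_def)
  ultimately show ?thesis unfolding permutes_def bij_iff by blast
qed

lemma less_add3_cases:
  fixes a b c l :: nat
  assumes "l < a + b + c"
  obtains "l < a" | k where "l = a + k" "k < b" | k where "l = a + b + k" "k < c"
proof (cases "l < a")
  case False
  show thesis
  proof (cases "l < a + b")
    case True
    with False have "l = a + (l - a)" "l - a < b" by simp_all
    then show thesis by (rule that(2))
  next
    case False
    with assms have "l = a + b + (l - (a + b))" "l - (a + b) < c" by simp_all
    then show thesis by (rule that(3))
  qed
qed (rule that(1))

lemma permute_list_append3:
  assumes "\<sigma> permutes {..<length xs}" "\<tau> permutes {..<length ys}" "\<rho> permutes {..<length zs}"
  shows "permute_list (block_perm (length xs, length ys, length zs) \<sigma> \<tau> \<rho>) (xs @ ys @ zs) =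
    permute_list \<sigma> xs @ permute_list \<tau> ys @ permute_list \<rho> zs"
proof (rule nth_equalityI)
  let ?p = "block_perm (length xs, length ys, length zs) \<sigma> \<tau> \<rho>"
  have p: "?p permutes {..<length (xs @ ys @ zs)}"
    using block_perm_permutes[OF assms] by (simp add: add.assoc)
  fix l assume "l < length (permute_list ?p (xs @ ys @ zs))"
  then have l: "l < length (xs @ ys @ zs)" by simp
  have "\<sigma> i < length xs \<longleftrightarrow> i < length xs" "\<tau> i < length ys \<longleftrightarrow> i < length ys"
      "\<rho> i < length zs \<longleftrightarrow> i < length zs" for i
    using permutes_in_image[OF assms(1)] permutes_in_image[OF assms(2)]
      permutes_in_image[OF assms(3)] by auto
  note in_range = this
  have "l < length xs + length ys + length zs" using l by simp
  then show "permute_list ?p (xs @ ys @ zs) ! l =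
      (permute_list \<sigma> xs @ permute_list \<tau> ys @ permute_list \<rho> zs) ! l"
    unfolding permute_list_nth[OF p l]
  proof (cases rule: less_add3_cases)
    case 1
    then have "?p l = \<sigma> l" by (simp add: block_perm_def)
    with 1 in_range(1)[of l] show "(xs @ ys @ zs) ! ?p l = (permute_list \<sigma> xs @ permute_list \<tau> ys @ permute_list \<rho> zs) ! l"
      by (simp add: nth_append permute_list_nth[OF assms(1)])
  next
    case (2 k)
    then have "?p l = length xs + \<tau> k" by (simp add: block_perm_def)
    with 2 in_range(2)[of k] show "(xs @ ys @ zs) ! ?p l = (permute_list \<sigma> xs @ permute_list \<tau> ys @ permute_list \<rho> zs) ! l"
      by (simp add: nth_append permute_list_nth[OF assms(2)])
  next
    case (3 k)
    then have "?p l = length xs + length ys + \<rho> k" by (simp add: block_perm_def)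
    with 3 in_range(3)[of k] show "(xs @ ys @ zs) ! ?p l = (permute_list \<sigma> xs @ permute_list \<tau> ys @ permute_list \<rho> zs) ! l"
      by (simp add: nth_append permute_list_nth[OF assms(3)])
  qed
qed simp

lemma zdim_eq: "zdim (n1, n2, n3) = 2 * (n1 + n2 + n3)"
  by (simp add: zdim_def)

text \<open>Closure of the block permutations under composition gives one inclusion of orbits. The reverse
  inclusion is obtained where it is needed by exchanging the roles of the two orderings, so
  inverses of the matrices never have to be computed.\<close>

lemma orbit_mat_act_subset:
  assumes A: "A \<subseteq> carrier_vec (zdim (n1, n2, n3))"
    and perm: "\<sigma> permutes {..<n1}" "\<tau> permutes {..<n2}" "\<rho> permutes {..<n3}"
  shows "orbit (block_perm_group (n1, n2, n3)) mat_act
      (mat_act (pair_perm_mat (zdim (n1, n2, n3)) (block_perm (n1, n2, n3) \<sigma> \<tau> \<rho>)) A)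
    \<subseteq> orbit (block_perm_group (n1, n2, n3)) mat_act A"
proof
  let ?bp = "block_perm (n1, n2, n3)" and ?n = "zdim (n1, n2, n3)"
  fix B assume "B \<in> orbit (block_perm_group (n1, n2, n3)) mat_act (mat_act (pair_perm_mat ?n (?bp \<sigma> \<tau> \<rho>)) A)"
  then obtain \<sigma>' \<tau>' \<rho>' where perm': "\<sigma>' permutes {..<n1}" "\<tau>' permutes {..<n2}" "\<rho>' permutes {..<n3}"
      and B: "B = mat_act (pair_perm_mat ?n (?bp \<sigma>' \<tau>' \<rho>')) (mat_act (pair_perm_mat ?n (?bp \<sigma> \<tau> \<rho>)) A)"
    by (auto simp: orbit_def block_perm_group_def)
  have "B = mat_act (pair_perm_mat ?n (?bp \<sigma>' \<tau>' \<rho>' \<circ> ?bp \<sigma> \<tau> \<rho>)) A"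
    unfolding B zdim_eq
    using A[unfolded zdim_eq] block_perm_permutes[OF perm] block_perm_permutes[OF perm']
    by (intro mat_act_comp)
  also have "?bp \<sigma>' \<tau>' \<rho>' \<circ> ?bp \<sigma> \<tau> \<rho> = ?bp (\<sigma>' \<circ> \<sigma>) (\<tau>' \<circ> \<tau>) (\<rho>' \<circ> \<rho>)"
    using perm by (rule block_perm_comp)
  finally show "B \<in> orbit (block_perm_group (n1, n2, n3)) mat_act A"
    using permutes_compose[OF perm(1) perm'(1)] permutes_compose[OF perm(2) perm'(2)]
      permutes_compose[OF perm(3) perm'(3)]
    unfolding orbit_def block_perm_group_def by auto
qed

section \<open>The affine subset attached to a triple of coefficient functions\<close>

definition mu_pairs ::
    "(int \<times> int \<times> int \<Rightarrow> int) \<Rightarrow> (int \<times> int \<times> int \<Rightarrow> int) \<Rightarrow> (int \<times> int \<times> int \<Rightarrow> int) \<Rightarrow>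
     (int \<times> int \<times> int) list \<Rightarrow> (int \<times> int \<times> int) list \<Rightarrow> (int \<times> int \<times> int) list \<Rightarrow>
     int \<Rightarrow> int \<Rightarrow> int \<Rightarrow> (int \<times> int) list" where
  "mu_pairs a b c la lb lc q1 q2 q3 =
     map (\<lambda>(i, j, k). (j + q1 * k + q2 * i, a (i, j, k))) la @
     map (\<lambda>(i, j, k). (j + q2 * k + q3 * i, b (i, j, k))) lb @
     map (\<lambda>(i, j, k). (j + q1 * i + q3 * k, c (i, j, k))) lc"

lemma length_mu_pairs [simp]:
  "length (mu_pairs a b c la lb lc q1 q2 q3) = length la + length lb + length lc"
  by (simp add: mu_pairs_def)

lemma mu_vec_eq_pairs_vec: "mu_vec a b c la lb lc q1 q2 q3 = pairs_vec (mu_pairs a b c la lb lc q1 q2 q3)"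
  unfolding mu_vec_def pairs_vec_def mu_pairs_def map_append concat_append map_map
  by (intro arg_cong[of _ _ vec_of_list] arg_cong2[of _ _ _ _ "(@)"] arg_cong[of _ _ concat]
      map_cong refl) auto

lemma mu_vec_carrier [simp]:
  "mu_vec a b c la lb lc q1 q2 q3 \<in> carrier_vec (zdim (length la, length lb, length lc))"
  unfolding mu_vec_eq_pairs_vec zdim_eq by (rule pairs_vec_carrier) simp

text \<open>The linear part of the parametrization by \<open>(q\<^sub>1, q\<^sub>2, q\<^sub>3)\<close>: the second entry of each pair and the
  contribution of \<open>j\<close> do not depend on the parameters, so both are set to zero.\<close>

definition mu_dir ::
    "(int \<times> int \<times> int) list \<Rightarrow> (int \<times> int \<times> int) list \<Rightarrow> (int \<times> int \<times> int) list \<Rightarrow>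
     int \<Rightarrow> int \<Rightarrow> int \<Rightarrow> int vec" where
  "mu_dir la lb lc = (let drop_j = map (\<lambda>(i, j, k). (i, 0, k)) in
     mu_vec (\<lambda>_. 0) (\<lambda>_. 0) (\<lambda>_. 0) (drop_j la) (drop_j lb) (drop_j lc))"

lemma mu_dir_carrier [simp]:
  "mu_dir la lb lc q1 q2 q3 \<in> carrier_vec (zdim (length la, length lb, length lc))"
  using mu_vec_carrier[of _ _ _ "map (\<lambda>(i, j, k). (i, 0, k)) la" "map (\<lambda>(i, j, k). (i, 0, k)) lb"
      "map (\<lambda>(i, j, k). (i, 0, k)) lc"] by (simp add: mu_dir_def Let_def)

lemma index_mu_vec:
  assumes "i < zdim (length la, length lb, length lc)"
  shows "mu_vec a b c la lb lc q1 q2 q3 $ i =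
    mu_vec a b c la lb lc 0 0 0 $ i + mu_dir la lb lc q1 q2 q3 $ i"
proof -
  have "i div 2 < length la + length lb + length lc"
    using assms by (auto simp: zdim_eq)
  then show ?thesis
    using assms
    by (cases rule: less_add3_cases) (simp_all add: mu_dir_def Let_def mu_vec_eq_pairs_vec index_pairs_vec zdim_eq mu_pairs_def
        nth_append split: prod.split)
qed

lemma index_mu_dir:
  assumes "i < zdim (length la, length lb, length lc)"
  shows "mu_dir la lb lc q1 q2 q3 $ i =
    q1 * mu_dir la lb lc 1 0 0 $ i + q2 * mu_dir la lb lc 0 1 0 $ i + q3 * mu_dir la lb lc 0 0 1 $ i"
proof -
  have "i div 2 < length la + length lb + length lc"
    using assms by (auto simp: zdim_eq)
  then show ?thesis
    using assms
    by (cases rule: less_add3_cases) (simp_all add: mu_dir_def Let_def mu_vec_eq_pairs_vec index_pairs_vec zdim_eq mu_pairs_def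
        nth_append split: prod.split)
qed

text \<open>The set is a translate of the image of the linear map \<open>mu_dir\<close> from \<open>\<int>\<^sup>3\<close>. Its rank is at most \<open>3\<close>
  because the image is generated by the values at the three unit vectors, but may be smaller.\<close>

lemma mu_set_affine:
  "\<exists>k\<le>3. mu_set a b c la lb lc \<in> affine_sets k (zdim (length la, length lb, length lc))"
proof -
  let ?n = "zdim (length la, length lb, length lc)"
  let ?D = "mu_dir la lb lc"
  let ?x = "mu_vec a b c la lb lc 0 0 0"
  define N where "N = {?D q1 q2 q3 | q1 q2 q3. True}"
  have dim: "dim_vec (?D q1 q2 q3) = ?n" for q1 q2 q3
    using mu_dir_carrier by (rule carrier_vecD)
  have D0: "?D 0 0 0 = 0\<^sub>v ?n"
  proof (rule eq_vecI)
    fix i assume "i < dim_vec (0\<^sub>v ?n :: int vec)"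
    then have "i < ?n" by simp
    from index_mu_dir[OF this, of 0 0 0] this show "?D 0 0 0 $ i = 0\<^sub>v ?n $ i" by simp
  qed (simp add: dim)
  have Dadd: "?D q1 q2 q3 + ?D p1 p2 p3 = ?D (q1 + p1) (q2 + p2) (q3 + p3)" for q1 q2 q3 p1 p2 p3
  proof (rule eq_vecI)
    fix i assume "i < dim_vec (?D (q1 + p1) (q2 + p2) (q3 + p3))"
    then have i: "i < ?n" by (simp add: dim)
    show "(?D q1 q2 q3 + ?D p1 p2 p3) $ i = ?D (q1 + p1) (q2 + p2) (q3 + p3) $ i"
      unfolding index_add_vec(1)[OF i[folded dim[of p1 p2 p3]]]
        index_mu_dir[OF i, of q1 q2 q3] index_mu_dir[OF i, of p1 p2 p3]
        index_mu_dir[OF i, of "q1 + p1" "q2 + p2" "q3 + p3"]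
      by (simp add: algebra_simps)
  qed (simp add: dim)
  have Dsmult: "s \<cdot>\<^sub>v ?D q1 q2 q3 = ?D (s * q1) (s * q2) (s * q3)" for s q1 q2 q3
  proof (rule eq_vecI)
    fix i assume "i < dim_vec (?D (s * q1) (s * q2) (s * q3))"
    then have i: "i < ?n" by (simp add: dim)
    show "(s \<cdot>\<^sub>v ?D q1 q2 q3) $ i = ?D (s * q1) (s * q2) (s * q3) $ i"
      unfolding index_smult_vec(1)[OF i[folded dim[of q1 q2 q3]]]
        index_mu_dir[OF i, of q1 q2 q3] index_mu_dir[OF i, of "s * q1" "s * q2" "s * q3"]
      by (simp add: algebra_simps)
  qed (simp add: dim)
  have sub: "LinearCombinations.submodule class_ring N (Zmod ?n)"
  proof (rule submoduleI)
    show "N \<subseteq> carrier_vec ?n" by (auto simp: N_def)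
    show "0\<^sub>v ?n \<in> N" unfolding N_def D0[symmetric] by blast
    show "x + y \<in> N" if "x \<in> N" "y \<in> N" for x y
      using that Dadd unfolding N_def by fast
    show "s \<cdot>\<^sub>v x \<in> N" if "x \<in> N" for s x
      using that Dsmult unfolding N_def by fast
  qed
  define v where "v = (\<lambda>(j :: nat) i. (if j = 0 then ?D 1 0 0 else if j = 1 then ?D 0 1 0 else ?D 0 0 1) $ i)"
  have rank: "Zrank ?n N \<le> 3"
  proof (rule Zrank_le[where v = v])
    show "N \<subseteq> carrier_vec ?n" by (auto simp: N_def)
    fix x assume "x \<in> N"
    then obtain q1 q2 q3 where x: "x = ?D q1 q2 q3" by (auto simp: N_def)
    define q where "q = (\<lambda>j :: nat. if j = 0 then q1 else if j = 1 then q2 else q3)"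
    have "x $ i = (\<Sum>j<3. q j * v j i)" if "i < ?n" for i
    proof -
      have "(\<Sum>j<3. f j) = f 0 + f 1 + f 2" for f :: "nat \<Rightarrow> int"
        by (simp add: eval_nat_numeral)
      then have sum: "(\<Sum>j<3. q j * v j i) = q1 * ?D 1 0 0 $ i + q2 * ?D 0 1 0 $ i + q3 * ?D 0 0 1 $ i"
        by (simp add: q_def v_def)
      show ?thesis unfolding x sum by (rule index_mu_dir[OF that])
    qed
    then show "\<exists>q. \<forall>i<?n. x $ i = (\<Sum>j<3. q j * v j i)" by blast
  qed
  have coset: "mu_set a b c la lb lc = {?x + y | y. y \<in> N}"
  proof -
    have eq: "mu_vec a b c la lb lc q1 q2 q3 = ?x + ?D q1 q2 q3" for q1 q2 q3
    proof (rule eq_vecI)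
      fix i assume "i < dim_vec (?x + ?D q1 q2 q3)"
      then have i: "i < ?n" by (simp add: dim)
      show "mu_vec a b c la lb lc q1 q2 q3 $ i = (?x + ?D q1 q2 q3) $ i"
        unfolding index_add_vec(1)[OF i[folded dim[of q1 q2 q3]]] by (rule index_mu_vec[OF i])
    next
      show "dim_vec (mu_vec a b c la lb lc q1 q2 q3) = dim_vec (?x + ?D q1 q2 q3)"
        using carrier_vecD[OF mu_vec_carrier[of a b c la lb lc q1 q2 q3]] by (simp add: dim)
    qed
    show ?thesis
    proof (intro equalityI subsetI)
      fix x assume "x \<in> mu_set a b c la lb lc"
      then obtain q1 q2 q3 where "x = mu_vec a b c la lb lc q1 q2 q3" unfolding mu_set_def by blast
      then have "x = ?x + ?D q1 q2 q3" by (rule trans[OF _ eq])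
      then show "x \<in> {?x + y | y. y \<in> N}" unfolding N_def by blast
    next
      fix x assume "x \<in> {?x + y | y. y \<in> N}"
      then obtain q1 q2 q3 where "x = ?x + ?D q1 q2 q3" unfolding N_def by blast
      then have "x = mu_vec a b c la lb lc q1 q2 q3" by (rule trans[OF _ eq[symmetric]])
      then show "x \<in> mu_set a b c la lb lc" unfolding mu_set_def by blast
    qed
  qed
  have "mu_set a b c la lb lc \<in> affine_sets (Zrank ?n N) ?n"
    unfolding affine_sets_def
    by (intro CollectI exI[of _ ?x] exI[of _ N] conjI coset mu_vec_carrier sub refl)
  with rank show ?thesis by blast
qed

lemma mu_set_affine_rank_le:
  "mu_set a b c la lb lc \<in> affine_sets k (zdim (length la, length lb, length lc)) \<Longrightarrow> k \<le> 3"
  using mu_set_affine affine_sets_rank_unique by blast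

section \<open>Independence of the ordering\<close>

lemma distinct_permute_list:
  assumes "distinct xs" "distinct ys" "set xs = set ys"
  obtains \<pi> where "\<pi> permutes {..<length ys}" "permute_list \<pi> ys = xs"
  using assms mset_eq_permutation[of xs ys] set_eq_iff_mset_eq_distinct by metis

text \<open>Reordering the nonzero coefficients permutes the pairs within each of the three blocks, uniformly
  in the parameters \<open>q\<^sub>1, q\<^sub>2, q\<^sub>3\<close>; a single matrix therefore carries one affine set to the other.\<close>

lemma mu_set_reorder:
  assumes a: "distinct la" "distinct la'" "set la = set la'"
    and b: "distinct lb" "distinct lb'" "set lb = set lb'"
    and c: "distinct lc" "distinct lc'" "set lc = set lc'"
  obtains \<sigma> \<tau> \<rho> where
    "\<sigma> permutes {..<length la}" "\<tau> permutes {..<length lb}" "\<rho> permutes {..<length lc}"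
    "mat_act (pair_perm_mat (zdim (length la, length lb, length lc))
        (block_perm (length la, length lb, length lc) \<sigma> \<tau> \<rho>)) (mu_set a b c la' lb' lc') =
      mu_set a b c la lb lc"
proof -
  obtain \<sigma> where \<sigma>: "\<sigma> permutes {..<length la}" "permute_list \<sigma> la = la'"
    using distinct_permute_list[OF a(2,1) a(3)[symmetric]] by blast
  obtain \<tau> where \<tau>: "\<tau> permutes {..<length lb}" "permute_list \<tau> lb = lb'"
    using distinct_permute_list[OF b(2,1) b(3)[symmetric]] by blast
  obtain \<rho> where \<rho>: "\<rho> permutes {..<length lc}" "permute_list \<rho> lc = lc'"
    using distinct_permute_list[OF c(2,1) c(3)[symmetric]] by blast
  let ?ns = "(length la, length lb, length lc)"
  let ?p = "block_perm ?ns \<sigma> \<tau> \<rho>"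
  let ?M = "pair_perm_mat (zdim ?ns) ?p"
  have M: "?M *\<^sub>v mu_vec a b c la' lb' lc' q1 q2 q3 = mu_vec a b c la lb lc q1 q2 q3" for q1 q2 q3
  proof -
    let ?P = "mu_pairs a b c la lb lc q1 q2 q3"
    have "permute_list (block_perm (length xs, length ys, length zs) \<sigma> \<tau> \<rho>) (xs @ ys @ zs) =
        permute_list \<sigma> xs @ permute_list \<tau> ys @ permute_list \<rho> zs"
      if "length xs = length la" "length ys = length lb" "length zs = length lc"
      for xs ys zs :: "(int \<times> int) list"
      using that \<sigma>(1) \<tau>(1) \<rho>(1) by (intro permute_list_append3) simp_all
    from this[of "map _ la" "map _ lb" "map _ lc", simplified length_map, OF refl refl refl]
    have "permute_list ?p ?P = mu_pairs a b c la' lb' lc' q1 q2 q3"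
      unfolding mu_pairs_def
      by (simp only: permute_list_map[OF \<sigma>(1)] permute_list_map[OF \<tau>(1)] permute_list_map[OF \<rho>(1)]
          \<sigma>(2) \<tau>(2) \<rho>(2))
    moreover have "?p permutes {..<length ?P}"
      using block_perm_permutes[OF \<sigma>(1) \<tau>(1) \<rho>(1)] by simp
    from pair_perm_mat_pairs_vec[OF this]
    have "?M *\<^sub>v pairs_vec (permute_list ?p ?P) = pairs_vec ?P"
      unfolding length_mu_pairs zdim_eq .
    ultimately show ?thesis unfolding mu_vec_eq_pairs_vec by simp
  qed
  have "mat_act ?M (mu_set a b c la' lb' lc') = {?M *\<^sub>v mu_vec a b c la' lb' lc' q1 q2 q3 | q1 q2 q3. True}"
    unfolding mat_act_def mu_set_def by blast
  then have "mat_act ?M (mu_set a b c la' lb' lc') = mu_set a b c la lb lc"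
    unfolding M mu_set_def .
  with \<sigma>(1) \<tau>(1) \<rho>(1) show thesis by (rule that)
qed

lemma mu_set_reorder_affine:
  assumes a: "distinct la" "distinct la'" "set la = set la'"
    and b: "distinct lb" "distinct lb'" "set lb = set lb'"
    and c: "distinct lc" "distinct lc'" "set lc = set lc'"
    and A: "mu_set a b c la' lb' lc' \<in> affine_sets k (zdim (length la, length lb, length lc))"
  shows "mu_set a b c la lb lc \<in> affine_sets k (zdim (length la, length lb, length lc))"
proof -
  obtain \<sigma> \<tau> \<rho> where
    p: "\<sigma> permutes {..<length la}" "\<tau> permutes {..<length lb}" "\<rho> permutes {..<length lc}" and
    M: "mat_act (pair_perm_mat (zdim (length la, length lb, length lc))
        (block_perm (length la, length lb, length lc) \<sigma> \<tau> \<rho>)) (mu_set a b c la' lb' lc') =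
      mu_set a b c la lb lc"
    by (rule mu_set_reorder[OF a b c])
  show ?thesis
    unfolding M[symmetric] using A unfolding zdim_eq
    by (rule mat_act_affine_sets[OF block_perm_permutes[OF p]])
qed

lemma mu_set_reorder_orbit:
  assumes a: "distinct la" "distinct la'" "set la = set la'"
    and b: "distinct lb" "distinct lb'" "set lb = set lb'"
    and c: "distinct lc" "distinct lc'" "set lc = set lc'"
  shows "orbit (block_perm_group (length la, length lb, length lc)) mat_act (mu_set a b c la lb lc)
    \<subseteq> orbit (block_perm_group (length la, length lb, length lc)) mat_act (mu_set a b c la' lb' lc')"
proof -
  obtain \<sigma> \<tau> \<rho> where
    p: "\<sigma> permutes {..<length la}" "\<tau> permutes {..<length lb}" "\<rho> permutes {..<length lc}" and
    M: "mat_act (pair_perm_mat (zdim (length la, length lb, length lc))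
        (block_perm (length la, length lb, length lc) \<sigma> \<tau> \<rho>)) (mu_set a b c la' lb' lc') =
      mu_set a b c la lb lc"
    by (rule mu_set_reorder[OF a b c])
  have "length la' = length la" "length lb' = length lb" "length lc' = length lc"
    using a b c by (metis distinct_card)+
  then have "mu_set a b c la' lb' lc' \<subseteq> carrier_vec (zdim (length la, length lb, length lc))"
    using mu_vec_carrier[of a b c la' lb' lc'] unfolding mu_set_def by auto
  from orbit_mat_act_subset[OF this p] show ?thesis unfolding M .
qed

section \<open>The map and its invariance\<close>

interpretation Hx: heis_letters Gy Gz Gs by unfold_locales simp_all
interpretation Hy: heis_letters Gz Gx Gt by unfold_locales simp_all
interpretation Hz: heis_letters Gx Gy Gu by unfold_locales simp_all

lemma K_carrier_iff_expands:
  "(v1, v2, v3) \<in> carrier K_ring \<longleftrightarrow>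
    (\<exists>a b c. expands Gy Gz Gs v1 a \<and> expands Gz Gx Gt v2 b \<and> expands Gx Gy Gu v3 c)"
  by (simp add: K_ring_def RDirProd_carrier Hx.expands_iff Hy.expands_iff Hz.expands_iff)

lemma expands_unique:
  "expands Gy Gz Gs v1 a \<Longrightarrow> expands Gy Gz Gs v1 a' \<Longrightarrow> a = a'"
  "expands Gz Gx Gt v2 b \<Longrightarrow> expands Gz Gx Gt v2 b' \<Longrightarrow> b = b'"
  "expands Gx Gy Gu v3 c \<Longrightarrow> expands Gx Gy Gu v3 c' \<Longrightarrow> c = c'"
  by (simp_all add: Hx.expands_iff Hy.expands_iff Hz.expands_iff)

lemma mu_relI:
  assumes "expands Gy Gz Gs v1 a" "expands Gz Gx Gt v2 b" "expands Gx Gy Gu v3 c"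
    "distinct la" "set la = {m. a m \<noteq> 0}" "distinct lb" "set lb = {m. b m \<noteq> 0}"
    "distinct lc" "set lc = {m. c m \<noteq> 0}"
    "mu_set a b c la lb lc \<in> affine_sets k (zdim (length la, length lb, length lc))"
  shows "mu_rel (v1, v2, v3) ((length la, length lb, length lc), k,
    orbit (block_perm_group (length la, length lb, length lc)) mat_act (mu_set a b c la lb lc))"
  unfolding mu_rel_def prod.case Let_def using assms by blast

lemma mu_relE:
  assumes "mu_rel (v1, v2, v3) X"
  obtains a b c la lb lc k where
    "expands Gy Gz Gs v1 a" "expands Gz Gx Gt v2 b" "expands Gx Gy Gu v3 c"
    "distinct la" "set la = {m. a m \<noteq> 0}" "distinct lb" "set lb = {m. b m \<noteq> 0}"
    "distinct lc" "set lc = {m. c m \<noteq> 0}"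
    "mu_set a b c la lb lc \<in> affine_sets k (zdim (length la, length lb, length lc))"
    "X = ((length la, length lb, length lc), k,
      orbit (block_perm_group (length la, length lb, length lc)) mat_act (mu_set a b c la lb lc))"
  using assms unfolding mu_rel_def prod.case Let_def by blast

lemma mu_rel_exists:
  assumes "v \<in> carrier K_ring"
  shows "\<exists>X. mu_rel v X"
proof -
  obtain v1 v2 v3 where v: "v = (v1, v2, v3)" by (cases v)
  with assms obtain a b c where
    e: "expands Gy Gz Gs v1 a" "expands Gz Gx Gt v2 b" "expands Gx Gy Gu v3 c"
    using K_carrier_iff_expands by blast
  then have "finite {m. a m \<noteq> 0}" "finite {m. b m \<noteq> 0}" "finite {m. c m \<noteq> 0}"
    by (simp_all add: expands_def)
  then obtain la lb lc where l: "distinct la" "set la = {m. a m \<noteq> 0}" "distinct lb"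
      "set lb = {m. b m \<noteq> 0}" "distinct lc" "set lc = {m. c m \<noteq> 0}"
    using finite_distinct_list by metis
  obtain k where k: "mu_set a b c la lb lc \<in> affine_sets k (zdim (length la, length lb, length lc))"
    using mu_set_affine by blast
  show ?thesis unfolding v using mu_relI[OF e l k] by (rule exI)
qed

text \<open>The coefficient functions are determined by \<open>v\<close>, so two values can differ only in the ordering
  of the supports. Reordering changes neither the orbit nor the rank.\<close>

lemma mu_rel_unique:
  assumes "mu_rel v X" "mu_rel v Y"
  shows "X = Y"
proof -
  obtain v1 v2 v3 where v: "v = (v1, v2, v3)" by (cases v)
  obtain a b c la lb lc k where
    e: "expands Gy Gz Gs v1 a" "expands Gz Gx Gt v2 b" "expands Gx Gy Gu v3 c"
    and l: "distinct la" "set la = {m. a m \<noteq> 0}" "distinct lb" "set lb = {m. b m \<noteq> 0}"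
    "distinct lc" "set lc = {m. c m \<noteq> 0}"
    and k: "mu_set a b c la lb lc \<in> affine_sets k (zdim (length la, length lb, length lc))"
    and X: "X = ((length la, length lb, length lc), k,
      orbit (block_perm_group (length la, length lb, length lc)) mat_act (mu_set a b c la lb lc))"
    using assms(1) unfolding v by (rule mu_relE)
  obtain a' b' c' la' lb' lc' k' where
    e': "expands Gy Gz Gs v1 a'" "expands Gz Gx Gt v2 b'" "expands Gx Gy Gu v3 c'"
    and l': "distinct la'" "set la' = {m. a' m \<noteq> 0}" "distinct lb'" "set lb' = {m. b' m \<noteq> 0}"
    "distinct lc'" "set lc' = {m. c' m \<noteq> 0}"
    and k': "mu_set a' b' c' la' lb' lc' \<in> affine_sets k' (zdim (length la', length lb', length lc'))"
    and Y: "Y = ((length la', length lb', length lc'), k',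
      orbit (block_perm_group (length la', length lb', length lc')) mat_act (mu_set a' b' c' la' lb' lc'))"
    using assms(2) unfolding v by (rule mu_relE)
  have abc: "a' = a" "b' = b" "c' = c"
    using expands_unique e e' by blast+
  have la: "distinct la" "distinct la'" "set la = set la'"
    and lb: "distinct lb" "distinct lb'" "set lb = set lb'"
    and lc: "distinct lc" "distinct lc'" "set lc = set lc'"
    using l l' abc by simp_all
  have len: "length la' = length la" "length lb' = length lb" "length lc' = length lc"
    using la lb lc by (metis distinct_card)+
  have "mu_set a b c la lb lc \<in> affine_sets k' (zdim (length la, length lb, length lc))"
    using k' unfolding len abc by (rule mu_set_reorder_affine[OF la lb lc])
  with k have "k = k'" by (rule affine_sets_rank_unique)
  moreover have "orbit (block_perm_group (length la, length lb, length lc)) mat_act (mu_set a b c la lb lc)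
    = orbit (block_perm_group (length la, length lb, length lc)) mat_act (mu_set a b c la' lb' lc')"
  proof
    show "orbit (block_perm_group (length la, length lb, length lc)) mat_act (mu_set a b c la' lb' lc')
      \<subseteq> orbit (block_perm_group (length la, length lb, length lc)) mat_act (mu_set a b c la lb lc)"
      using mu_set_reorder_orbit[OF la(2,1) la(3)[symmetric] lb(2,1) lb(3)[symmetric]
          lc(2,1) lc(3)[symmetric], of a b c] unfolding len .
  qed (rule mu_set_reorder_orbit[OF la lb lc])
  ultimately show ?thesis unfolding X Y len abc by simp
qed

lemma mu_eqI: "mu_rel v X \<Longrightarrow> mu v = X"
  unfolding mu_def using mu_rel_unique by blast

lemma mu_rel_calA:
  assumes "mu_rel v X"
  shows "X \<in> calA"
proof -
  obtain v1 v2 v3 where v: "v = (v1, v2, v3)" by (cases v)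
  obtain a b c la lb lc k where
    k: "mu_set a b c la lb lc \<in> affine_sets k (zdim (length la, length lb, length lc))"
    and X: "X = ((length la, length lb, length lc), k,
      orbit (block_perm_group (length la, length lb, length lc)) mat_act (mu_set a b c la lb lc))"
    using assms unfolding v by (rule mu_relE)
  have "k \<in> {0..3}" using mu_set_affine_rank_le[OF k] by simp
  then show ?thesis
    unfolding X calA_def calA_block_def orbits_def using k by blast
qed

text \<open>The heart of the descent: a shear of the exponents is absorbed by a translation of the parameters.
  The point is that each of the three numbers \<open>\<alpha>\<close>, \<open>\<beta>\<close>, \<open>\<gamma>\<close> occurs in two blocks, and in both it shifts the
  same parameter: \<open>q\<^sub>1\<close> by \<open>\<beta>\<close>, \<open>q\<^sub>2\<close> by \<open>\<alpha>\<close> and \<open>q\<^sub>3\<close> by \<open>\<gamma>\<close>.\<close>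

lemma mu_set_shear:
  fixes \<alpha> \<beta> \<gamma> :: int
  defines "s\<^sub>1 \<equiv> \<lambda>(i, j, k). (i, j + \<alpha> * i + \<beta> * k, k)"
    and "s\<^sub>2 \<equiv> \<lambda>(i, j, k). (i, j + \<gamma> * i + \<alpha> * k, k)"
    and "s\<^sub>3 \<equiv> \<lambda>(i, j, k). (i, j + \<beta> * i + \<gamma> * k, k)"
  shows "mu_set (\<lambda>(i, j, k). a (i, j - \<alpha> * i - \<beta> * k, k)) (\<lambda>(i, j, k). b (i, j - \<gamma> * i - \<alpha> * k, k))
      (\<lambda>(i, j, k). c (i, j - \<beta> * i - \<gamma> * k, k)) (map s\<^sub>1 la) (map s\<^sub>2 lb) (map s\<^sub>3 lc) =
    mu_set a b c la lb lc" (is "mu_set ?a ?b ?c _ _ _ = _")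
proof -
  have shift: "mu_vec ?a ?b ?c (map s\<^sub>1 la) (map s\<^sub>2 lb) (map s\<^sub>3 lc) q1 q2 q3 =
      mu_vec a b c la lb lc (q1 + \<beta>) (q2 + \<alpha>) (q3 + \<gamma>)" for q1 q2 q3
    unfolding mu_vec_eq_pairs_vec mu_pairs_def map_map
    by (intro arg_cong[of _ _ pairs_vec] arg_cong2[of _ _ _ _ "(@)"] map_cong refl)
      (auto simp: s\<^sub>1_def s\<^sub>2_def s\<^sub>3_def algebra_simps)
  show ?thesis
  proof
    show "mu_set ?a ?b ?c (map s\<^sub>1 la) (map s\<^sub>2 lb) (map s\<^sub>3 lc) \<subseteq> mu_set a b c la lb lc"
      unfolding mu_set_def shift by blast
    show "mu_set a b c la lb lc \<subseteq> mu_set ?a ?b ?c (map s\<^sub>1 la) (map s\<^sub>2 lb) (map s\<^sub>3 lc)"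
    proof
      fix x assume "x \<in> mu_set a b c la lb lc"
      then obtain q1 q2 q3 where "x = mu_vec a b c la lb lc q1 q2 q3" unfolding mu_set_def by blast
      then have "x = mu_vec ?a ?b ?c (map s\<^sub>1 la) (map s\<^sub>2 lb) (map s\<^sub>3 lc) (q1 - \<beta>) (q2 - \<alpha>) (q3 - \<gamma>)"
        by (simp add: shift)
      then show "x \<in> mu_set ?a ?b ?c (map s\<^sub>1 la) (map s\<^sub>2 lb) (map s\<^sub>3 lc)"
        unfolding mu_set_def by blast
    qed
  qed
qed

lemma shear_support:
  fixes a :: "int \<times> int \<times> int \<Rightarrow> int" and \<alpha> \<beta> :: int
  assumes "distinct l" "set l = {m. a m \<noteq> 0}"
  shows "distinct (map (\<lambda>(i, j, k). (i, j + \<alpha> * i + \<beta> * k, k)) l)"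
    "set (map (\<lambda>(i, j, k). (i, j + \<alpha> * i + \<beta> * k, k)) l) =
      {m. (\<lambda>(i, j, k). a (i, j - \<alpha> * i - \<beta> * k, k)) m \<noteq> 0}"
proof -
  let ?s = "\<lambda>(i, j, k). (i, j + \<alpha> * i + \<beta> * k, k)" and ?t = "\<lambda>(i, j, k). (i, j - \<alpha> * i - \<beta> * k, k)"
  have ts: "?t (?s m) = m" and st: "?s (?t m) = m" for m by (cases m; simp)+
  have "inj_on ?s (set l)" using ts by (rule inj_on_inverseI)
  then show "distinct (map ?s l)" using assms(1) by (simp only: distinct_map)
  have "?s ` {m. a m \<noteq> 0} = {m. a (?t m) \<noteq> 0}"
  proof (intro equalityI subsetI)
    fix m assume "m \<in> {m. a (?t m) \<noteq> 0}"
    then show "m \<in> ?s ` {m. a m \<noteq> 0}" by (intro image_eqI[where x = "?t m"]) (simp_all only: st mem_Collect_eq not_False_eq_True)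
  next
    fix m assume "m \<in> ?s ` {m. a m \<noteq> 0}"
    then obtain m' where "a m' \<noteq> 0" "m = ?s m'" by blast
    then show "m \<in> {m. a (?t m) \<noteq> 0}" by (simp only: ts mem_Collect_eq not_False_eq_True)
  qed
  then show "set (map ?s l) = {m. (\<lambda>(i, j, k). a (i, j - \<alpha> * i - \<beta> * k, k)) m \<noteq> 0}"
    unfolding set_map assms(2) by (simp only: split_beta)
qed

lemma mu_rel_act:
  assumes "mu_rel v X"
  shows "mu_rel (K_act g v) X"
proof -
  obtain v1 v2 v3 where v: "v = (v1, v2, v3)" by (cases v)
  obtain d1 d2 d3 d4 d5 d6 where g: "g = (d1, d2, d3, d4, d5, d6)" by (cases g)
  obtain a b c la lb lc k where
    e: "expands Gy Gz Gs v1 a" "expands Gz Gx Gt v2 b" "expands Gx Gy Gu v3 c"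
    and l: "distinct la" "set la = {m. a m \<noteq> 0}" "distinct lb" "set lb = {m. b m \<noteq> 0}"
    "distinct lc" "set lc = {m. c m \<noteq> 0}"
    and k: "mu_set a b c la lb lc \<in> affine_sets k (zdim (length la, length lb, length lc))"
    and X: "X = ((length la, length lb, length lc), k,
      orbit (block_perm_group (length la, length lb, length lc)) mat_act (mu_set a b c la lb lc))"
    using assms unfolding v by (rule mu_relE)
  \<comment> \<open>the three differences through which \<open>\<int>\<^sup>6\<close> acts\<close>
  let ?\<alpha> = "d2 - d3" and ?\<beta> = "d6 - d1" and ?\<gamma> = "d4 - d5"
  show ?thesis
    unfolding v g K_act_def prod.case X
    using mu_relI[OF Hx.expands_shear[OF e(1), of ?\<alpha> ?\<beta>] Hy.expands_shear[OF e(2), of ?\<gamma> ?\<alpha>]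
        Hz.expands_shear[OF e(3), of ?\<beta> ?\<gamma>] shear_support[OF l(1,2), of ?\<alpha> ?\<beta>]
        shear_support[OF l(3,4), of ?\<gamma> ?\<alpha>] shear_support[OF l(5,6), of ?\<beta> ?\<gamma>],
        unfolded mu_set_shear length_map, OF k] .
qed

lemma mu_rel_mu:
  assumes "v \<in> carrier K_ring"
  shows "mu_rel v (mu v)"
proof -
  obtain X where X: "mu_rel v X" using mu_rel_exists[OF assms] ..
  then show ?thesis unfolding mu_eqI[OF X] .
qed

lemma mu_act: "v \<in> carrier K_ring \<Longrightarrow> mu (K_act g v) = mu v"
  by (intro mu_eqI mu_rel_act mu_rel_mu)

lemma K_act_zero:
  assumes "v \<in> carrier K_ring"
  shows "K_act (0, 0, 0, 0, 0, 0) v = v"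
proof -
  obtain v1 v2 v3 where v: "v = (v1, v2, v3)" by (cases v)
  with assms obtain a b c where
    e: "expands Gy Gz Gs v1 a" "expands Gz Gx Gt v2 b" "expands Gx Gy Gu v3 c"
    using K_carrier_iff_expands by blast
  have eq: "u = w" if "expands p q r u f" "expands p q r w f" for p q r u w f
    using that by (simp add: expands_def)
  have "(\<lambda>(i, j, k). f (i, j - 0 * i - 0 * k, k)) = f" for f :: "int \<times> int \<times> int \<Rightarrow> int"
    by (simp add: fun_eq_iff)
  then show ?thesis
    using eq[OF Hx.expands_shear[OF e(1), of 0 0]] eq[OF Hy.expands_shear[OF e(2), of 0 0]]
      eq[OF Hz.expands_shear[OF e(3), of 0 0]] e
    by (simp add: v K_act_def)
qed

text \<open>Equal orbits thus have representatives that differ by the action of some element, which is all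
  the descent needs.\<close>

lemma self_in_orbit:
  assumes "v \<in> carrier K_ring"
  shows "v \<in> orbit Z6 K_act v"
proof -
  have "(0, 0, 0, 0, 0, 0) \<in> carrier Z6" by (simp add: Z6_def)
  then show ?thesis unfolding orbit_def
    using K_act_zero[OF assms, symmetric] by (intro CollectI exI conjI)
qed

theorem proposition5p22:
  shows "(\<forall>v\<in>carrier K_ring. \<exists>!X. mu_rel v X) \<and>
         mu \<in> carrier K_ring \<rightarrow> calA \<and>
         (\<exists>!mubar. mubar \<in> K_tilde \<rightarrow>\<^sub>E calA \<and>
            (\<forall>v\<in>carrier K_ring. mubar (orbit Z6 K_act v) = mu v))"
proof (intro conjI)
  show "\<forall>v\<in>carrier K_ring. \<exists>!X. mu_rel v X"
    using mu_rel_exists mu_rel_unique by blast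
  have calA: "mu v \<in> calA" if "v \<in> carrier K_ring" for v
    using mu_rel_mu[OF that] by (rule mu_rel_calA)
  then show "mu \<in> carrier K_ring \<rightarrow> calA" by blast
  have same: "mu v = mu w"
    if v: "v \<in> carrier K_ring" and w: "w \<in> carrier K_ring" and eq: "orbit Z6 K_act v = orbit Z6 K_act w" for v w
  proof -
    have "v \<in> orbit Z6 K_act w" using self_in_orbit[OF v] eq by simp
    then obtain g where "v = K_act g w" unfolding orbit_def by blast
    then show ?thesis using mu_act[OF w] by simp
  qed
  \<comment> \<open>a chosen representative of each orbit; the value of \<open>\<mu>\<close> does not depend on the choice\<close>
  define rep where "rep O' = (SOME v. v \<in> carrier K_ring \<and> O' = orbit Z6 K_act v)" for O'
  have rep: "mu (rep (orbit Z6 K_act v)) = mu v" if v: "v \<in> carrier K_ring" for v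
  proof -
    have "rep (orbit Z6 K_act v) \<in> carrier K_ring \<and>
        orbit Z6 K_act v = orbit Z6 K_act (rep (orbit Z6 K_act v))"
      unfolding rep_def using v by (intro someI_ex[of "\<lambda>w. w \<in> carrier K_ring \<and> orbit Z6 K_act v = orbit Z6 K_act w"]) blast
    then show ?thesis using same[OF _ v] by metis
  qed
  show "\<exists>!mubar. mubar \<in> K_tilde \<rightarrow>\<^sub>E calA \<and>
      (\<forall>v\<in>carrier K_ring. mubar (orbit Z6 K_act v) = mu v)"
  proof (rule ex1I[of _ "restrict (mu \<circ> rep) K_tilde"])
    have "restrict (mu \<circ> rep) K_tilde Q \<in> calA" if Q: "Q \<in> K_tilde" for Q
    proof -
      obtain v where v: "v \<in> carrier K_ring" "Q = orbit Z6 K_act v"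
        using Q unfolding K_tilde_def orbits_def by blast
      then show ?thesis using Q rep[OF v(1)] calA[OF v(1)] by simp
    qed
    moreover have "restrict (mu \<circ> rep) K_tilde (orbit Z6 K_act v) = mu v"
      if v: "v \<in> carrier K_ring" for v
    proof -
      have "orbit Z6 K_act v \<in> K_tilde" unfolding K_tilde_def orbits_def using v by blast
      then show ?thesis using rep[OF v] by simp
    qed
    ultimately show "restrict (mu \<circ> rep) K_tilde \<in> K_tilde \<rightarrow>\<^sub>E calA \<and>
        (\<forall>v\<in>carrier K_ring. restrict (mu \<circ> rep) K_tilde (orbit Z6 K_act v) = mu v)"
      by (intro conjI ballI PiE_I restrict_extensional) (simp_all only: restrict_apply if_False)
  next
    fix f assume f: "f \<in> K_tilde \<rightarrow>\<^sub>E calA \<and> (\<forall>v\<in>carrier K_ring. f (orbit Z6 K_act v) = mu v)"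
    show "f = restrict (mu \<circ> rep) K_tilde"
    proof (rule extensionalityI[of _ K_tilde])
      show "f \<in> extensional K_tilde" using f by (simp add: PiE_def)
      fix Q assume Q: "Q \<in> K_tilde"
      then obtain v where v: "v \<in> carrier K_ring" "Q = orbit Z6 K_act v"
        unfolding K_tilde_def orbits_def by blast
      have "f Q = mu v" using f v by blast
      moreover have "restrict (mu \<circ> rep) K_tilde Q = mu v" using Q rep[OF v(1)] v(2) by simp
      ultimately show "f Q = restrict (mu \<circ> rep) K_tilde Q" by simp
    qed simp
  qed
qed

end
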